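(* Let $\mathbb{T}=\mathbb{S}^1(\tfrac12)\times\mathbb{S}^1(\tfrac12)$ be the flat torus and let $\Phi:\mathbb{T}\to\mathbb{S}^4\subset\mathbb{R}^5$ be the proper biharmonic isometric immersion $$\Phi(\gamma,\vartheta)=\Big(\tfrac12\cos\gamma,\ \tfrac12\sin\gamma,\ \tfrac12\cos\vartheta,\ \tfrac12\sin\vartheta,\ \tfrac1{\sqrt2}\Big),\qquad 0\le\gamma,\vartheta\le 2\pi .$$ Then (i) $\mathrm{Index}_2(\Phi)=1$; (ii) $\mathrm{Null}_2(\Phi)=11$.
   Context: $\mathbb{S}^n(R)$ is the Euclidean $n$-sphere of radius $R$, $\mathbb{S}^n=\mathbb{S}^n(1)$. The torus $\mathbb{T}=\mathbb{S}^1(\frac12)\times\mathbb{S}^1(\frac12)$ carries the product metric $\frac14(d\gamma^2+d\vartheta^2)$ in the angular coordinates $\gamma,\vartheta$. For a smooth map $\phi:(M,g)\to(N,h)$ with $M$ compact, the tension field is $\tau(\phi)=\mathrm{trace}\,\nabla d\phi$ (a section of $\phi^{-1}TN$), and the bienergy is $E_2(\phi)=\frac12\int_M|\tau(\phi)|^2\,dv_M$. The map $\phi$ is biharmonic if it is a critical point of $E_2$, and proper biharmonic if moreover $\tau(\phi)\neq0$. For a biharmonic map $\phi$, the generalised Jacobi operator $I_2=I_2^\phi$ is the fourth-order elliptic self-adjoint operator on the space $\mathcal{C}(\phi^{-1}TN)$ of smooth sections of $\phi^{-1}TN$ determined by $$\frac{\partial^2}{\partial t\,\partial s}\Big|_{(0,0)}E_2(\phi_{t,s})=\int_M\langle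 I_2(V),W\rangle\,dv_M$$ for every smooth two-parameter variation $\phi_{t,s}$ of $\phi=\phi_{0,0}$ with $V=\partial_t\phi_{t,0}|_{t=0}$, $W=\partial_s\phi_{0,s}|_{s=0}$. When $N=\mathbb{S}^n$, with $\{e_i\}$ a local orthonormal frame on $M$, $\nabla=\nabla^\phi$ the induced connection on $\phi^{-1}TN$ and $\overline\Delta=-\sum_i(\nabla^\phi_{e_i}\nabla^\phi_{e_i}-\nabla^\phi_{\nabla^M_{e_i}e_i})$ the rough Laplacian, explicitly $$\begin{aligned}I_2(V)=&\ \overline\Delta^2V+\overline\Delta\Big(\sum_i\langle V,d\phi(e_i)\rangle d\phi(e_i)-|d\phi|^2V\Big)+2\sum_i\langle\nabla_{e_i}\tau(\phi),d\phi(e_i)\rangle V+|\tau(\phi)|^2V\\&-2\sum_i\langle V,\nabla_{e_i}\tau(\phi)\rangle d\phi(e_i)-2\sum_i\langle\tau(\phi),\nabla_{e_i}V\rangle d\phi(e_i)-\langle\tau(\phi),V\rangle\tau(\phi)\\&+\sum_i\langle d\phi(e_i),\overline\Delta V\rangle d\phi(e_i)+\sum_{i,j}\langle V,d\phi(e_j)\rangle\langle d\phi(e_i),d\phi(e_j)\rangle d\phi(e_i)\\&-2|d\phi|^2\sum_i\langle d\phi(e_i),V\rangle d\phi(e_i)+2\sum_i\langle\nabla_{e_i}V,d\phi(e_i)\rangle\tau(\phi)-|d\phi|^2\overline\Delta V+|d\phi|^4V.\end{aligned}$$ The spectrum $\mu_1<\mu_2<\cdots$ of $I_2$ is discrete and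 tends to $+\infty$; let $\mathcal{V}_i$ be the eigenspace of $\mu_i$. Then $\mathrm{Index}_2(\phi)=\sum_{\mu_i<0}\dim\mathcal{V}_i$ and $\mathrm{Null}_2(\phi)=\dim\mathrm{Ker}(I_2)$. *)

theory Defs
  imports "HOL-Analysis.Analysis" "HOL-Library.Function_Algebras" "HOL-Library.Extended_Nat"
begin

(* C^k and C^infinity maps; the latter means that all iterated directional derivatives exist
   and are (Frechet) differentiable. *)

primrec times_differentiable ::
    "nat \<Rightarrow> ('a::real_normed_vector \<Rightarrow> 'b::real_normed_vector) \<Rightarrow> bool" where
  "times_differentiable 0 f \<longleftrightarrow> continuous_on UNIV f"
| "times_differentiable (Suc k) f \<longleftrightarrow>
     (\<forall>x. f differentiable (at x)) \<and>
     (\<forall>v. times_differentiable k (\<lambda>x. frechet_derivative f (at x) v))"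

definition smooth :: "('a::real_normed_vector \<Rightarrow> 'b::real_normed_vector) \<Rightarrow> bool" where
  "smooth f \<longleftrightarrow> (\<forall>k. times_differentiable k f)"

(* The torus S^1(1/2) x S^1(1/2) is described in its angular coordinates (gamma, theta):
   maps and sections on it are 2 pi-periodic maps on the plane, and the product metric is
   (d gamma^2 + d theta^2) / 4. *)

definition periodic :: "(real \<times> real \<Rightarrow> 'a) \<Rightarrow> bool" where
  "periodic f \<longleftrightarrow> (\<forall>x y. f (x + 2 * pi, y) = f (x, y) \<and> f (x, y + 2 * pi) = f (x, y))"

definition torus_metric :: "real \<times> real \<Rightarrow> real \<times> real \<Rightarrow> real" where
  "torus_metric u v = (u \<bullet> v) / 4"

(* The volume form of the metric is (1/4) d gamma d theta. *)
definition torus_integral :: "(real \<times> real \<Rightarrow> real) \<Rightarrow> real" where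
  "torus_integral f = integral (cbox (0, 0) (2 * pi, 2 * pi)) (\<lambda>p. f p / 4)"

(* The orthonormal frame 2 d/d gamma, 2 d/d theta. It is parallel, so the
   Christoffel terms in the tension field and in the rough Laplacian vanish. *)
definition frame :: "(real \<times> real) set" where
  "frame = {(2, 0), (0, 2)}"

lemma frame_orthonormal:
  assumes "u \<in> frame" "v \<in> frame"
  shows "torus_metric u v = (if u = v then 1 else 0)"
  using assms by (auto simp: frame_def torus_metric_def)

definition torus_sphere_map :: "(real \<times> real \<Rightarrow> 'a::euclidean_space) \<Rightarrow> bool" where
  "torus_sphere_map \<phi> \<longleftrightarrow> smooth \<phi> \<and> periodic \<phi> \<and> range \<phi> \<subseteq> sphere 0 1"

definition diff :: "(real \<times> real \<Rightarrow> 'a::euclidean_space) \<Rightarrow> real \<times> real \<Rightarrow> real \<times> real \<Rightarrow> 'a" where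
  "diff \<phi> e p = frechet_derivative \<phi> (at p) e"

definition isometric_immersion :: "(real \<times> real \<Rightarrow> 'a::euclidean_space) \<Rightarrow> bool" where
  "isometric_immersion \<phi> \<longleftrightarrow> torus_sphere_map \<phi> \<and>
     (\<forall>p u v. diff \<phi> u p \<bullet> diff \<phi> v p = torus_metric u v)"

(* The tangent space of the unit sphere at x is the orthogonal complement of x. *)
definition sections :: "(real \<times> real \<Rightarrow> 'a::euclidean_space) \<Rightarrow> (real \<times> real \<Rightarrow> 'a) set" where
  "sections \<phi> = {V. smooth V \<and> periodic V \<and> (\<forall>p. V p \<bullet> \<phi> p = 0)}"

(* The connection induced by the Levi-Civita connection of the unit sphere: the tangential
   part of the derivative in the ambient Euclidean space. *)
definition nabla ::
    "(real \<times> real \<Rightarrow> 'a::euclidean_space) \<Rightarrow> real \<times> real \<Rightarrow> (real \<times> real \<Rightarrow> 'a) \<Rightarrow> real \<times> real \<Rightarrow> 'a" where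
  "nabla \<phi> e V p = diff V e p - (diff V e p \<bullet> \<phi> p) *\<^sub>R \<phi> p"

definition tension :: "(real \<times> real \<Rightarrow> 'a::euclidean_space) \<Rightarrow> real \<times> real \<Rightarrow> 'a" where
  "tension \<phi> p = (\<Sum>e\<in>frame. nabla \<phi> e (diff \<phi> e) p)"

definition bienergy :: "(real \<times> real \<Rightarrow> 'a::euclidean_space) \<Rightarrow> real" where
  "bienergy \<phi> = 1 / 2 * torus_integral (\<lambda>p. (norm (tension \<phi> p))\<^sup>2)"

definition smooth_variation ::
    "(real \<times> real \<Rightarrow> 'a::euclidean_space) \<Rightarrow> (real \<Rightarrow> real \<times> real \<Rightarrow> 'a) \<Rightarrow> bool" where
  "smooth_variation \<phi> F \<longleftrightarrow>
     smooth (\<lambda>(t, p). F t p) \<and> (\<forall>t. torus_sphere_map (F t)) \<and> F 0 = \<phi>"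

definition biharmonic :: "(real \<times> real \<Rightarrow> 'a::euclidean_space) \<Rightarrow> bool" where
  "biharmonic \<phi> \<longleftrightarrow> torus_sphere_map \<phi> \<and>
     (\<forall>F. smooth_variation \<phi> F \<longrightarrow>
        ((\<lambda>t. bienergy (F t)) has_real_derivative 0) (at 0))"

definition proper_biharmonic :: "(real \<times> real \<Rightarrow> 'a::euclidean_space) \<Rightarrow> bool" where
  "proper_biharmonic \<phi> \<longleftrightarrow> biharmonic \<phi> \<and> (\<exists>p. tension \<phi> p \<noteq> 0)"

definition rough_laplacian ::
    "(real \<times> real \<Rightarrow> 'a::euclidean_space) \<Rightarrow> (real \<times> real \<Rightarrow> 'a) \<Rightarrow> real \<times> real \<Rightarrow> 'a" where
  "rough_laplacian \<phi> V p = - (\<Sum>e\<in>frame. nabla \<phi> e (nabla \<phi> e V) p)"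

definition diff_norm_sq :: "(real \<times> real \<Rightarrow> 'a::euclidean_space) \<Rightarrow> real \<times> real \<Rightarrow> real" where
  "diff_norm_sq \<phi> p = (\<Sum>e\<in>frame. (norm (diff \<phi> e p))\<^sup>2)"

(* The generalised Jacobi operator I_2 of a biharmonic map into the unit sphere, by its
   explicit formula for the Hessian of the bienergy. *)
definition jacobi2 ::
    "(real \<times> real \<Rightarrow> 'a::euclidean_space) \<Rightarrow> (real \<times> real \<Rightarrow> 'a) \<Rightarrow> real \<times> real \<Rightarrow> 'a" where
  "jacobi2 \<phi> V p =
     rough_laplacian \<phi> (rough_laplacian \<phi> V) p
   + rough_laplacian \<phi>
       (\<lambda>q. (\<Sum>e\<in>frame. (V q \<bullet> diff \<phi> e q) *\<^sub>R diff \<phi> e q) - diff_norm_sq \<phi> q *\<^sub>R V q) p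
   + (2 * (\<Sum>e\<in>frame. nabla \<phi> e (tension \<phi>) p \<bullet> diff \<phi> e p)) *\<^sub>R V p
   + (norm (tension \<phi> p))\<^sup>2 *\<^sub>R V p
   - 2 *\<^sub>R (\<Sum>e\<in>frame. (V p \<bullet> nabla \<phi> e (tension \<phi>) p) *\<^sub>R diff \<phi> e p)
   - 2 *\<^sub>R (\<Sum>e\<in>frame. (tension \<phi> p \<bullet> nabla \<phi> e V p) *\<^sub>R diff \<phi> e p)
   - (tension \<phi> p \<bullet> V p) *\<^sub>R tension \<phi> p
   + (\<Sum>e\<in>frame. (diff \<phi> e p \<bullet> rough_laplacian \<phi> V p) *\<^sub>R diff \<phi> e p)
   + (\<Sum>e\<in>frame. \<Sum>e'\<in>frame.
        ((V p \<bullet> diff \<phi> e' p) * (diff \<phi> e p \<bullet> diff \<phi> e' p)) *\<^sub>R diff \<phi> e p)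
   - (2 * diff_norm_sq \<phi> p) *\<^sub>R (\<Sum>e\<in>frame. (diff \<phi> e p \<bullet> V p) *\<^sub>R diff \<phi> e p)
   + (2 * (\<Sum>e\<in>frame. nabla \<phi> e V p \<bullet> diff \<phi> e p)) *\<^sub>R tension \<phi> p
   - diff_norm_sq \<phi> p *\<^sub>R rough_laplacian \<phi> V p
   + (diff_norm_sq \<phi> p)\<^sup>2 *\<^sub>R V p"

definition eigenspace ::
    "(real \<times> real \<Rightarrow> 'a::euclidean_space) \<Rightarrow> real \<Rightarrow> (real \<times> real \<Rightarrow> 'a) set" where
  "eigenspace \<phi> \<mu> = {V \<in> sections \<phi>. \<forall>p. jacobi2 \<phi> V p = \<mu> *\<^sub>R V p}"

definition kernel ::
    "(real \<times> real \<Rightarrow> 'a::euclidean_space) \<Rightarrow> (real \<times> real \<Rightarrow> 'a) set" where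
  "kernel \<phi> = {V \<in> sections \<phi>. \<forall>p. jacobi2 \<phi> V p = 0}"

interpretation fun_space: vector_space
  "\<lambda>(c::real) (f :: 'b \<Rightarrow> 'a::real_vector) x. c *\<^sub>R f x"
  by unfold_locales (auto simp: scaleR_add_right scaleR_add_left)

(* The library dimension of an infinite-dimensional space is 0; here it is infinity. *)
definition edim :: "('b \<Rightarrow> 'a::real_vector) set \<Rightarrow> enat" where
  "edim E = (if \<exists>B. finite B \<and> E \<subseteq> fun_space.span B then enat (fun_space.dim E) else \<infinity>)"

definition negative_eigenvalues :: "(real \<times> real \<Rightarrow> 'a::euclidean_space) \<Rightarrow> real set" where
  "negative_eigenvalues \<phi> = {\<mu>. \<mu> < 0 \<and> (\<exists>V \<in> eigenspace \<phi> \<mu>. \<exists>p. V p \<noteq> 0)}"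

(* An infinite sum of positive dimensions is infinity, whereas sum would give 0. *)
definition index2 :: "(real \<times> real \<Rightarrow> 'a::euclidean_space) \<Rightarrow> enat" where
  "index2 \<phi> =
     (if finite (negative_eigenvalues \<phi>)
      then \<Sum>\<mu>\<in>negative_eigenvalues \<phi>. edim (eigenspace \<phi> \<mu>) else \<infinity>)"

definition null2 :: "(real \<times> real \<Rightarrow> 'a::euclidean_space) \<Rightarrow> enat" where
  "null2 \<phi> = edim (kernel \<phi>)"

definition Phi :: "real \<times> real \<Rightarrow> real^5" where
  "Phi = (\<lambda>(\<gamma>, \<theta>).
     vector [1/2 * cos \<gamma>, 1/2 * sin \<gamma>, 1/2 * cos \<theta>, 1/2 * sin \<theta>, 1 / sqrt 2])"

lemma vector_5:
  "(vector [a, b, c, d, e] :: 'a::zero^5) $ 1 = a"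
  "(vector [a, b, c, d, e] :: 'a::zero^5) $ 2 = b"
  "(vector [a, b, c, d, e] :: 'a::zero^5) $ 3 = c"
  "(vector [a, b, c, d, e] :: 'a::zero^5) $ 4 = d"
  "(vector [a, b, c, d, e] :: 'a::zero^5) $ 5 = e"
  by (simp_all add: vector_def)

end

theory Submission
  imports Defs
begin

text \<open>
  The bundle $\Phi^{-1}T\mathbb{S}^4$ has a global frame (tangents tang1, tang2, normals norm1, norm2)
  whose covariant derivatives are combinations of the frame with constant coefficients. In this
  frame $I_2$ is therefore an operator with constant coefficients, and it decouples over the Fourier
  modes $(m, n)$ into symmetric $4 \times 4$ matrices. The quadratic form of such a matrix is
  positive semidefinite for $(m, n) \neq (0, 0)$ and positive definite if $|m| > 1$ or $|n| > 1$.
  The zero mode contributes the single negative eigenvalue $-16$, on multiples of $\tau(\Phi)$, and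
  three dimensions of kernel; each of the mode pairs $\pm(1, 0)$, $\pm(0, 1)$, $\pm(1, 1)$,
  $\pm(1, -1)$ contributes two more. Completeness of the trigonometric system turns these statements
  about Fourier coefficients into statements about sections.
\<close>

section \<open>Smooth maps\<close>

text \<open>Only signs of the mode forms matter, so neither characteristic polynomials nor
  ellipticity enter: pairing a mode equation of an eigenfield with its own coefficients shows that
  the form equals \<mu> times a weighted sum of their squares. A nonnegative form then excludes the
  mode for \<mu> < 0, a definite one also for \<mu> = 0. The obstacle is the infinity of modes
  together with thin margins: the uniform estimate starts at m^2 + n^2 = 8, and the modes below it
  need exact identities.

  The number 11 has a geometric reading. The values of \<open>Phi\<close> span R^5, so the
  ten-dimensional space of Killing fields of the sphere restricts injectively to \<open>Phi\<close>,
  and the bienergy is invariant under rotations. The remaining direction is the constant multiple of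
  \<open>norm1\<close>, which changes the radii of the two circles in opposite senses. The negative
  direction \<open>norm2\<close> pushes the torus off the small hypersphere x_5 = 1/sqrt 2 that
  contains it.\<close>

lemma times_differentiable_imp_continuous:
  "times_differentiable k f \<Longrightarrow> continuous_on UNIV f"
  by (cases k) (auto simp: continuous_on_eq_continuous_within
      intro!: differentiable_imp_continuous_within)

lemma times_differentiable_Suc_imp:
  "times_differentiable (Suc k) f \<Longrightarrow> times_differentiable k f"
proof (induction k arbitrary: f)
  case 0
  then show ?case using times_differentiable_imp_continuous[of "Suc 0" f] by simp
next
  case (Suc k)
  then show ?case using times_differentiable.simps(2) by metis
qed

lemma times_differentiable_const: "times_differentiable k (\<lambda>x. c)"
  by (induction k arbitrary: c) (auto intro: continuous_intros)

lemma times_differentiable_add: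
  assumes "times_differentiable k f" "times_differentiable k g"
  shows "times_differentiable k (\<lambda>x. f x + g x)"
  using assms
proof (induction k arbitrary: f g)
  case 0
  then show ?case by (auto intro: continuous_intros)
next
  case (Suc k)
  have "((\<lambda>x. f x + g x) has_derivative
      (\<lambda>v. frechet_derivative f (at x) v + frechet_derivative g (at x) v)) (at x)" for x
    using Suc.prems by (auto intro!: has_derivative_add simp: frechet_derivative_works)
  note * = this frechet_derivative_at[OF this, symmetric]
  show ?case using Suc * by (auto simp: differentiable_def)
qed

lemma times_differentiable_bilinear:
  assumes "bounded_bilinear b" "times_differentiable k f" "times_differentiable k g"
  shows "times_differentiable k (\<lambda>x. b (f x) (g x))"
  using assms(2,3)
proof (induction k arbitrary: f g)
  case 0
  then show ?case using bounded_bilinear.continuous_on[OF assms(1)] by auto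
next
  case (Suc k)
  have "((\<lambda>x. b (f x) (g x)) has_derivative
      (\<lambda>v. b (f x) (frechet_derivative g (at x) v) + b (frechet_derivative f (at x) v) (g x))) (at x)" for x
    using Suc.prems
    by (intro bounded_bilinear.FDERIV[OF assms(1)]) (auto simp: frechet_derivative_works)
  note * = this frechet_derivative_at[OF this, symmetric]
  \<comment> \<open>The product rule leaves one factor undifferentiated, so the induction hypothesis
    also needs \<open>f\<close> and \<open>g\<close> themselves at the lower order.\<close>
  have "times_differentiable k f" "times_differentiable k g"
    using Suc.prems times_differentiable_Suc_imp by blast+
  then show ?case using Suc *
    by (auto simp: differentiable_def intro!: times_differentiable_add)
qed

text \<open>The free phase \<open>c\<close> closes the family under differentiation, since each
  derivative shifts it by pi/2. Sine is the case c = -pi/2.\<close>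

lemma times_differentiable_cos_linear:
  assumes "bounded_linear l"
  shows "times_differentiable k (\<lambda>x. cos (l x + c :: real))"
proof (induction k arbitrary: c)
  case 0
  then show ?case by (auto intro!: continuous_intros linear_continuous_on[OF assms])
next
  case (Suc k)
  have "((\<lambda>x. cos (l x + c)) has_derivative (\<lambda>v. cos (l x + (c + pi / 2)) * l v)) (at x)" for x
    unfolding add.assoc[symmetric] cos_add[of _ "pi / 2"]
    by (rule has_derivative_eq_rhs, (rule derivative_intros bounded_linear_imp_has_derivative[OF assms])+)
      (simp add: fun_eq_iff)
  note * = this frechet_derivative_at[OF this, symmetric]
  show ?case using Suc * times_differentiable_bilinear[OF bounded_bilinear_mult Suc times_differentiable_const]
    by (auto simp: differentiable_def)
qed

lemma smooth_imp_differentiable: "smooth f \<Longrightarrow> f differentiable (at x)"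
  unfolding smooth_def by (metis times_differentiable.simps(2))

lemma smooth_has_derivative:
  "smooth f \<Longrightarrow> (f has_derivative frechet_derivative f (at x)) (at x)"
  using smooth_imp_differentiable frechet_derivative_works by blast

lemma smooth_imp_continuous_on: "smooth f \<Longrightarrow> continuous_on S f"
  unfolding smooth_def using times_differentiable_imp_continuous continuous_on_subset by blast

lemma smooth_frechet_derivative:
  "smooth f \<Longrightarrow> smooth (\<lambda>x. frechet_derivative f (at x) v)"
  unfolding smooth_def by (metis times_differentiable.simps(2))

lemma smooth_const: "smooth (\<lambda>x. c)"
  by (simp add: smooth_def times_differentiable_const)

lemma smooth_bilinear:
  "bounded_bilinear b \<Longrightarrow> smooth f \<Longrightarrow> smooth g \<Longrightarrow> smooth (\<lambda>x. b (f x) (g x))"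
  by (simp add: smooth_def times_differentiable_bilinear)

lemma smooth_add: "smooth f \<Longrightarrow> smooth g \<Longrightarrow> smooth (\<lambda>x. f x + g x)"
  by (simp add: smooth_def times_differentiable_add)

lemma smooth_scaleR: "smooth f \<Longrightarrow> smooth g \<Longrightarrow> smooth (\<lambda>x. f x *\<^sub>R g x)"
  by (rule smooth_bilinear[OF bounded_bilinear_scaleR])

lemma smooth_inner: "smooth f \<Longrightarrow> smooth g \<Longrightarrow> smooth (\<lambda>x. f x \<bullet> g x)"
  by (rule smooth_bilinear[OF bounded_bilinear_inner])

lemma smooth_mult:
  fixes f g :: "'a::real_normed_vector \<Rightarrow> real"
  shows "smooth f \<Longrightarrow> smooth g \<Longrightarrow> smooth (\<lambda>x. f x * g x)"
  by (rule smooth_bilinear[OF bounded_bilinear_mult])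

lemma smooth_divide: "smooth f \<Longrightarrow> smooth (\<lambda>x. f x / c :: real)"
  using smooth_mult[OF _ smooth_const, of f "inverse c"] by (simp add: divide_inverse)

lemma smooth_minus: "smooth f \<Longrightarrow> smooth (\<lambda>x. - f x)"
  using smooth_scaleR[OF smooth_const[of "-1"], of f] by simp

lemma smooth_diff_fun: "smooth f \<Longrightarrow> smooth g \<Longrightarrow> smooth (\<lambda>x. f x - g x)"
  using smooth_add[OF _ smooth_minus, of f g] by simp

lemma smooth_sum: "(\<And>i. i \<in> I \<Longrightarrow> smooth (f i)) \<Longrightarrow> smooth (\<lambda>x. \<Sum>i\<in>I. f i x)"
  by (induction I rule: infinite_finite_induct) (auto intro: smooth_const smooth_add)

lemma smooth_diff: "smooth f \<Longrightarrow> smooth (diff f e)"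
  unfolding diff_def by (rule smooth_frechet_derivative)

lemma smooth_cos_linear: "bounded_linear l \<Longrightarrow> smooth (\<lambda>x. cos (l x + c :: real))"
  by (simp add: smooth_def times_differentiable_cos_linear)

lemmas smooth_intros = smooth_const smooth_add smooth_scaleR smooth_inner smooth_mult
  smooth_minus smooth_diff_fun smooth_sum smooth_diff smooth_divide

section \<open>Directional derivatives and periodicity\<close>

lemma diff_eq: "(f has_derivative f') (at p) \<Longrightarrow> diff f e p = f' e"
  unfolding diff_def using frechet_derivative_at by metis

lemma has_derivative_diff: "smooth f \<Longrightarrow> (f has_derivative (\<lambda>e. diff f e p)) (at p)"
  unfolding diff_def by (rule smooth_has_derivative)

lemma diff_const: "diff (\<lambda>p. c) e = (\<lambda>p. 0)"
  by (simp add: diff_def fun_eq_iff)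

lemma diff_add: "smooth f \<Longrightarrow> smooth g \<Longrightarrow>
    diff (\<lambda>p. f p + g p) e = (\<lambda>p. diff f e p + diff g e p)"
  by (rule ext, rule diff_eq) (auto intro!: has_derivative_add has_derivative_diff)

lemma diff_diff: "smooth f \<Longrightarrow> smooth g \<Longrightarrow>
    diff (\<lambda>p. f p - g p) e = (\<lambda>p. diff f e p - diff g e p)"
  by (rule ext, rule diff_eq) (auto intro!: has_derivative_diff has_derivative_diff Deriv.has_derivative_diff)

lemma diff_minus: "smooth f \<Longrightarrow> diff (\<lambda>p. - f p) e = (\<lambda>p. - diff f e p)"
  by (rule ext, rule diff_eq) (auto intro!: has_derivative_minus has_derivative_diff)

lemma diff_scaleR: "smooth f \<Longrightarrow> smooth g \<Longrightarrow>
    diff (\<lambda>p. f p *\<^sub>R g p) e = (\<lambda>p. f p *\<^sub>R diff g e p + diff f e p *\<^sub>R g p)"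
  by (rule ext, rule diff_eq) (auto intro!: has_derivative_scaleR has_derivative_diff)

lemma diff_inner: "smooth f \<Longrightarrow> smooth g \<Longrightarrow>
    diff (\<lambda>p. f p \<bullet> g p) e = (\<lambda>p. f p \<bullet> diff g e p + diff f e p \<bullet> g p)"
  by (rule ext, rule diff_eq) (auto intro!: has_derivative_inner has_derivative_diff)

lemma diff_mult: "smooth f \<Longrightarrow> smooth g \<Longrightarrow>
    diff (\<lambda>p. f p * g p :: real) e = (\<lambda>p. f p * diff g e p + diff f e p * g p)"
  by (rule ext, rule diff_eq) (auto intro!: has_derivative_mult has_derivative_diff)

lemma diff_cmult: "smooth f \<Longrightarrow> diff (\<lambda>p. c * f p :: real) e = (\<lambda>p. c * diff f e p)"
  by (simp add: diff_mult smooth_const diff_const)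

lemma diff_divide: "smooth f \<Longrightarrow> diff (\<lambda>p. f p / c :: real) e = (\<lambda>p. diff f e p / c)"
  by (simp add: divide_inverse diff_mult smooth_const diff_const)

lemmas diff_rules = diff_const diff_add diff_diff diff_minus diff_scaleR diff_inner diff_mult diff_cmult
  diff_divide

lemma periodic_const: "periodic (\<lambda>p. c)"
  by (simp add: periodic_def)

lemma periodic_compose2: "periodic f \<Longrightarrow> periodic g \<Longrightarrow> periodic (\<lambda>p. h (f p) (g p))"
  by (simp add: periodic_def)

lemma periodic_compose: "periodic f \<Longrightarrow> periodic (\<lambda>p. h (f p))"
  by (simp add: periodic_def)

lemma periodic_diff:
  assumes "smooth f" "periodic f"
  shows "periodic (diff f e)"
proof -
  have *: "diff f e (p + s) = diff f e p" if "\<And>p. f (p + s) = f p" for s p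
  proof -
    have "((\<lambda>p. f (p + s)) has_derivative (\<lambda>e. diff f e (p + s))) (at p)"
      by (rule has_derivative_eq_rhs[OF has_derivative_compose[OF _ has_derivative_diff[OF assms(1)], of _ "\<lambda>x. x"]])
        (auto intro!: derivative_eq_intros)
    then show ?thesis
      using that by (simp add: diff_eq)
  qed
  have "f (p + (2 * pi, 0)) = f p" "f (p + (0, 2 * pi)) = f p" for p
    using assms(2) by (cases p; simp add: periodic_def)+
  from this[THEN *] show ?thesis
    unfolding periodic_def by (metis add_Pair add.right_neutral)
qed

lemmas periodic_intros = periodic_const periodic_diff
  periodic_compose2[where h = "\<lambda>x y. x + y"] periodic_compose2[where h = "\<lambda>x y. x - y"]
  periodic_compose2[where h = "\<lambda>x y. x * y"] periodic_compose2[where h = "\<lambda>x y. x *\<^sub>R y"]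
  periodic_compose2[where h = "\<lambda>x y. x \<bullet> y"] periodic_compose[where h = "\<lambda>x. - x"]
  periodic_compose[where h = "\<lambda>x. x / c" for c]

section \<open>Integration by parts on the torus\<close>

lemma integrable_smooth:
  fixes f :: "real \<times> real \<Rightarrow> real"
  shows "smooth f \<Longrightarrow> f integrable_on cbox a b"
  by (intro integrable_continuous smooth_imp_continuous_on)

lemma integral_line_derivative:
  fixes f :: "real \<times> real \<Rightarrow> real"
  assumes "smooth f" "\<And>t. p t = p 0 + t *\<^sub>R e" "f (p (2 * pi)) = f (p 0)"
  shows "integral {0..2 * pi} (\<lambda>t. diff f e (p t)) = 0"
proof -
  have "((\<lambda>t. f (p t)) has_vector_derivative diff f e (p t)) (at t within {0..2 * pi})" for t
  proof -
    have 1: "(p has_derivative (\<lambda>t. t *\<^sub>R e)) (at t)"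
      by (subst assms(2)[abs_def]) (auto intro!: derivative_eq_intros)
    have "((\<lambda>t. f (p t)) has_derivative (\<lambda>s. diff f (s *\<^sub>R e) (p t))) (at t)"
      using has_derivative_compose[OF 1 has_derivative_diff[OF assms(1)]] by simp
    moreover have "diff f (s *\<^sub>R e) (p t) = s *\<^sub>R diff f e (p t)" for s
      using linear_scale[OF has_derivative_linear[OF has_derivative_diff[OF assms(1)]]] .
    ultimately show ?thesis
      unfolding has_vector_derivative_def by (auto intro: has_derivative_at_withinI)
  qed
  from fundamental_theorem_of_calculus[OF _ this] show ?thesis
    using assms(3) by (auto intro: integral_unique)
qed

text \<open>The divergence theorem on a closed surface: the derivative along a closed coordinate
  circle integrates to zero, and Fubini makes that circle the inner variable.\<close>

lemma integral_diff_periodic: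
  fixes f :: "real \<times> real \<Rightarrow> real"
  assumes f: "smooth f" "periodic f" and e: "e \<in> frame"
  shows "integral (cbox (0, 0) (2 * pi, 2 * pi)) (diff f e) = 0"
proof -
  have cont: "continuous_on S (diff f v)" for S v
    using f by (intro smooth_imp_continuous_on smooth_diff)
  have lin: "linear (\<lambda>e. diff f e p)" for p
    using has_derivative_linear[OF has_derivative_diff[OF f(1)]] .
  \<comment> \<open>The orthonormal frame is twice the coordinate frame, while the coordinate
    circles close up after 2 pi at unit coordinate speed.\<close>
  have "diff f (2, 0) p = 2 * diff f (1, 0) p" "diff f (0, 2) p = 2 * diff f (0, 1) p" for p
    using linear_scale[OF lin, of 2 "(1,0)"] linear_scale[OF lin, of 2 "(0,1)"] by auto
  then have two: "diff f (2, 0) = (\<lambda>p. 2 * diff f (1, 0) p)" "diff f (0, 2) = (\<lambda>p. 2 * diff f (0, 1) p)"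
    by auto
  have per: "f (2 * pi, y) = f (0, y)" "f (x, 2 * pi) = f (x, 0)" for x y
    using f(2) unfolding periodic_def by (metis add_0)+
  have 1: "integral {0..2 * pi} (\<lambda>x. diff f (1, 0) (x, y)) = 0" for y
    by (intro integral_line_derivative[OF f(1)]) (auto simp: per)
  have 2: "integral {0..2 * pi} (\<lambda>y. diff f (0, 1) (x, y)) = 0" for x
    by (intro integral_line_derivative[OF f(1)]) (auto simp: per)
  have "integral (cbox (0, 0) (2 * pi, 2 * pi)) (diff f (1, 0)) =
      integral (cbox 0 (2 * pi)) (\<lambda>x. integral (cbox 0 (2 * pi)) (\<lambda>y. diff f (1, 0) (x, y)))"
    by (rule integral_prod_continuous[OF cont])
  also have "\<dots> = integral (cbox 0 (2 * pi)) (\<lambda>y. integral (cbox 0 (2 * pi)) (\<lambda>x. diff f (1, 0) (x, y)))"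
    by (rule integral_swap_continuous) (simp add: cont)
  finally have 3: "integral (cbox (0, 0) (2 * pi, 2 * pi)) (diff f (1, 0)) = 0"
    by (simp add: 1)
  have 4: "integral (cbox (0, 0) (2 * pi, 2 * pi)) (diff f (0, 1)) = 0"
    by (subst integral_prod_continuous[OF cont]) (simp add: 2)
  show ?thesis
    using e unfolding frame_def by (auto simp: two 3 4)
qed

lemma torus_integral_add: "smooth f \<Longrightarrow> smooth g \<Longrightarrow>
    torus_integral (\<lambda>p. f p + g p) = torus_integral f + torus_integral g"
  by (simp add: torus_integral_def integral_add integrable_smooth add_divide_distrib)

lemma torus_integral_diff: "smooth f \<Longrightarrow> smooth g \<Longrightarrow>
    torus_integral (\<lambda>p. f p - g p) = torus_integral f - torus_integral g"
  by (simp add: torus_integral_def Henstock_Kurzweil_Integration.integral_diff integrable_smooth diff_divide_distrib)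

lemma torus_integral_cmult: "torus_integral (\<lambda>p. c * f p) = c * torus_integral f"
  by (simp add: torus_integral_def)

lemma torus_integral_minus: "torus_integral (\<lambda>p. - f p) = - torus_integral f"
  by (simp add: torus_integral_def)

lemma torus_integral_by_parts:
  fixes f g :: "real \<times> real \<Rightarrow> 'a::euclidean_space"
  assumes "smooth f" "periodic f" "smooth g" "periodic g" "e \<in> frame"
  shows "torus_integral (\<lambda>p. diff f e p \<bullet> g p) = - torus_integral (\<lambda>p. f p \<bullet> diff g e p)"
proof -
  have "torus_integral (\<lambda>p. f p \<bullet> diff g e p) + torus_integral (\<lambda>p. diff f e p \<bullet> g p)
      = torus_integral (diff (\<lambda>p. f p \<bullet> g p) e)"
    using assms by (simp add: torus_integral_add smooth_intros diff_inner)
  also have "\<dots> = 0"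
    using assms integral_diff_periodic[of "\<lambda>p. f p \<bullet> g p" e]
    by (simp add: torus_integral_def smooth_intros periodic_intros)
  finally show ?thesis by simp
qed

section \<open>Fourier series on the torus\<close>

text \<open>The shift \<open>c\<close> lets a single family of cosines contain the sines as well,
  and later treats both real coefficients of a mode at once.\<close>

definition phase :: "int \<Rightarrow> int \<Rightarrow> real \<Rightarrow> real \<times> real \<Rightarrow> real" where
  "phase m n c p = m * fst p + n * snd p + c"

lemma smooth_cos_phase: "smooth (\<lambda>p. cos (phase m n c p))"
  unfolding phase_def by (rule smooth_cos_linear) (intro bounded_linear_intros)

lemma sin_phase_eq: "sin (phase m n c p) = cos (phase m n (c - pi / 2) p)"
  using cos_sin_eq[of "phase m n (c - pi / 2) p"] sin_minus[of "phase m n c p - pi"]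
  by (simp add: phase_def algebra_simps cos_diff cos_add sin_add)

lemma smooth_sin_phase: "smooth (\<lambda>p. sin (phase m n c p))"
  unfolding sin_phase_eq by (rule smooth_cos_phase)

lemma periodic_sin_cos_phase:
  "periodic (\<lambda>p. cos (phase m n c p))" "periodic (\<lambda>p. sin (phase m n c p))"
proof -
  have *: "phase m n c (x + 2 * pi, y) = phase m n c (x, y) + 2 * pi * m"
    "phase m n c (x, y + 2 * pi) = phase m n c (x, y) + 2 * pi * n" for x y
    by (simp_all add: phase_def algebra_simps)
  show "periodic (\<lambda>p. cos (phase m n c p))" "periodic (\<lambda>p. sin (phase m n c p))"
    unfolding periodic_def * sin_add cos_add by (simp_all add: sin_int_2pin cos_int_2pin)
qed

lemma has_derivative_phase: "(phase m n c has_derivative (\<lambda>e. m * fst e + n * snd e)) (at p)"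
  unfolding phase_def[abs_def] by (auto intro!: derivative_eq_intros)

lemma diff_cos_phase: "diff (\<lambda>p. cos (phase m n c p)) e =
    (\<lambda>p. - (m * fst e + n * snd e) * sin (phase m n c p))"
  by (rule ext, rule diff_eq, rule has_derivative_eq_rhs,
      rule has_derivative_cos[OF has_derivative_phase]) (simp add: fun_eq_iff algebra_simps)

lemma diff_sin_phase: "diff (\<lambda>p. sin (phase m n c p)) e =
    (\<lambda>p. (m * fst e + n * snd e) * cos (phase m n c p))"
  by (rule ext, rule diff_eq, rule has_derivative_eq_rhs,
      rule has_derivative_sin[OF has_derivative_phase]) (simp add: fun_eq_iff)

lemmas trig_intros = smooth_cos_phase smooth_sin_phase periodic_sin_cos_phase

lemma torus_integral_const: "torus_integral (\<lambda>p. c) = pi\<^sup>2 * c"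
  by (simp add: torus_integral_def content_Pair power2_eq_square)

text \<open>The frame derivatives of the sine are 2m and 2n times the cosine and integrate to zero,
  so the integral is annihilated by both m and n.\<close>

lemma torus_integral_cos_phase:
  "torus_integral (\<lambda>p. cos (phase m n c p)) = (if m = 0 \<and> n = 0 then pi\<^sup>2 * cos c else 0)"
proof -
  have "torus_integral (diff (\<lambda>p. sin (phase m n c p)) e) = 0" if "e \<in> frame" for e
    using integral_diff_periodic[OF smooth_sin_phase periodic_sin_cos_phase(2) that]
    by (simp add: torus_integral_def)
  from this[of "(2, 0)"] this[of "(0, 2)"]
  have "m * torus_integral (\<lambda>p. cos (phase m n c p)) = 0" "n * torus_integral (\<lambda>p. cos (phase m n c p)) = 0"
    by (auto simp: frame_def diff_sin_phase torus_integral_cmult)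
  then show ?thesis by (auto simp: phase_def torus_integral_const)
qed

section \<open>Trigonometric polynomials and completeness\<close>

lemma cos_phase_mult: "cos (phase m n c p) * cos (phase m' n' c' p) =
    1 / 2 * (cos (phase (m + m') (n + n') (c + c') p) + cos (phase (m - m') (n - n') (c - c') p))"
  unfolding cos_times_cos by (simp add: phase_def algebra_simps)

text \<open>Shifted cosines suffice as generators: constants are multiples of mode (0, 0), sines are
  shifts, and products reduce to sums by \<open>cos_phase_mult\<close>.\<close>

inductive trig_poly :: "(real \<times> real \<Rightarrow> real) \<Rightarrow> bool" where
  trig_poly_cos: "trig_poly (\<lambda>p. cos (phase m n c p))"
| trig_poly_add: "trig_poly f \<Longrightarrow> trig_poly g \<Longrightarrow> trig_poly (\<lambda>p. f p + g p)"
| trig_poly_cmult: "trig_poly f \<Longrightarrow> trig_poly (\<lambda>p. r * f p)"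

lemma trig_poly_const: "trig_poly (\<lambda>p. r)"
  using trig_poly_cmult[OF trig_poly_cos[of 0 0 0], of r] by (simp add: phase_def)

lemma trig_poly_mult:
  assumes "trig_poly f" "trig_poly g"
  shows "trig_poly (\<lambda>p. f p * g p)"
  using assms(1)
proof induction
  case (trig_poly_cos m n c)
  show ?case using assms(2)
  proof induction
    case (trig_poly_cos m' n' c')
    show ?case unfolding cos_phase_mult by (intro trig_poly.intros)
  next
    case (trig_poly_add f g)
    then show ?case by (simp add: distrib_left trig_poly.intros)
  next
    case (trig_poly_cmult f r)
    then show ?case using trig_poly.trig_poly_cmult by (simp add: mult.left_commute)
  qed
next
  case (trig_poly_add f g)
  then show ?case by (simp add: distrib_right trig_poly.intros)
next
  case (trig_poly_cmult f r)
  then show ?case using trig_poly.trig_poly_cmult by (simp add: mult.assoc)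
qed

text \<open>Realises the torus as a compact set in C^2, on which polynomials in the four real
  coordinates become trigonometric polynomials in the angles.\<close>

definition torus_param :: "real \<times> real \<Rightarrow> complex \<times> complex" where
  "torus_param p = (cis (fst p), cis (snd p))"

lemma trig_poly_real_polynomial_function:
  assumes "real_polynomial_function q"
  shows "trig_poly (\<lambda>p. q (torus_param p))"
  using assms
proof induction
  case (linear l)
  interpret bounded_linear l by fact
  have "l (torus_param p) = (l (1, 0) * cos (phase 1 0 0 p) + l (\<i>, 0) * cos (phase 1 0 (- (pi / 2)) p)) +
      (l (0, 1) * cos (phase 0 1 0 p) + l (0, \<i>) * cos (phase 0 1 (- (pi / 2)) p))" for p
  proof -
    have "torus_param p = (cos (fst p) *\<^sub>R (1, 0) + sin (fst p) *\<^sub>R (\<i>, 0)) +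
        (cos (snd p) *\<^sub>R (0, 1) + sin (snd p) *\<^sub>R (0, \<i>))"
      by (simp add: torus_param_def complex_eq_iff)
    moreover have "cos (phase 1 0 (- (pi / 2)) p) = sin (fst p)" "cos (phase 0 1 (- (pi / 2)) p) = sin (snd p)"
      by (simp_all add: phase_def cos_diff)
    ultimately show ?thesis
      by (simp only: add scaleR) (simp add: phase_def)
  qed
  then show ?case by (auto intro!: trig_poly.intros)
qed (auto intro: trig_poly_const trig_poly_add trig_poly_mult)

lemma trig_poly_smooth: "trig_poly f \<Longrightarrow> smooth f"
  by (induction rule: trig_poly.induct) (auto intro: smooth_intros smooth_cos_phase)

lemma periodic_int_shift:
  assumes "periodic f"
  shows "f (x + 2 * pi * real_of_int k, y + 2 * pi * real_of_int l) = f (x, y)"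
proof -
  have 1: "f (x + 2 * pi * real_of_int k, y) = f (x, y)" for x y
  proof (induction k rule: int_induct[where k = 0])
    case (step1 i)
    then show ?case using assms unfolding periodic_def by (metis add.assoc distrib_left mult.right_neutral of_int_1 of_int_add)
  next
    case (step2 i)
    have "x + 2 * pi * real_of_int i = (x + 2 * pi * real_of_int (i - 1)) + 2 * pi" by (simp add: algebra_simps)
    then show ?case using step2 assms unfolding periodic_def by metis
  qed auto
  have 2: "f (x, y + 2 * pi * real_of_int l) = f (x, y)" for x y
  proof (induction l rule: int_induct[where k = 0])
    case (step1 i)
    then show ?case using assms unfolding periodic_def by (metis add.assoc distrib_left mult.right_neutral of_int_1 of_int_add)
  next
    case (step2 i)
    have "y + 2 * pi * real_of_int i = (y + 2 * pi * real_of_int (i - 1)) + 2 * pi" by (simp add: algebra_simps)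
    then show ?case using step2 assms unfolding periodic_def by metis
  qed auto
  show ?thesis using 1 2 by simp
qed

lemma periodic_eq_if_torus_param_eq:
  assumes "periodic f" "torus_param p = torus_param q"
  shows "f p = f q"
proof -
  have "sin (fst p) = sin (fst q) \<and> cos (fst p) = cos (fst q)" "sin (snd p) = sin (snd q) \<and> cos (snd p) = cos (snd q)"
    using assms(2) by (auto simp: torus_param_def complex_eq_iff)
  then obtain k l :: int where "fst p = fst q + 2 * pi * k" "snd p = snd q + 2 * pi * l"
    unfolding sin_cos_eq_iff by blast
  then have "p = (fst q + 2 * pi * k, snd q + 2 * pi * l)" by (simp add: prod_eq_iff)
  then show ?thesis using periodic_int_shift[OF assms(1)] by (metis prod.collapse)
qed

lemma torus_param_surj_cell: "\<exists>q \<in> cbox (0, 0) (2 * pi, 2 * pi). torus_param q = torus_param p"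
proof -
  have "\<exists>t. 0 \<le> t \<and> t \<le> 2 * pi \<and> cis t = cis x" for x
    by (metis Arg2pi_eq Arg2pi_ge_0 Arg2pi_lt_2pi cis_conv_exp less_imp_le mult_1 norm_cis of_real_1)
  then obtain s t where "0 \<le> s" "s \<le> 2 * pi" "cis s = cis (fst p)" "0 \<le> t" "t \<le> 2 * pi" "cis t = cis (snd p)"
    by metis
  then show ?thesis by (intro bexI[of _ "(s, t)"]) (auto simp: torus_param_def)
qed

text \<open>On the cell itself Stone-Weierstrass would yield polynomials in the angles. Therefore
  \<open>f\<close> is first pushed down to the image torus in C^2, whose polynomials pull back to
  trigonometric ones.\<close>

lemma trig_poly_approximation:
  assumes f: "smooth f" "periodic f" and e: "0 < e"
  obtains q where "trig_poly q" "\<And>p. p \<in> cbox (0, 0) (2 * pi, 2 * pi) \<Longrightarrow> \<bar>f p - q p\<bar> < e"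
proof -
  define S where "S = cbox (0 :: real, 0 :: real) (2 * pi, 2 * pi)"
  define T where "T = torus_param ` S"
  \<comment> \<open>\<open>inv_into\<close> picks some parameter of \<open>z\<close>; periodicity
    makes the value independent of the choice.\<close>
  define g where "g z = f (inv_into S torus_param z)" for z
  have g: "g (torus_param p) = f p" if "p \<in> S" for p
    unfolding g_def by (rule periodic_eq_if_torus_param_eq[OF f(2)]) (simp add: f_inv_into_f that)
  have cont: "continuous_on S torus_param"
    unfolding torus_param_def[abs_def] by (intro continuous_intros)
  have "compact S" by (simp add: S_def)
  then have "compact T" using cont by (simp add: T_def compact_continuous_image)
  \<comment> \<open>A continuous map from a compact space onto a Hausdorff space is a quotient map,
    so continuity of \<open>g\<close> can be tested on the cell, where it is the continuity of
    \<open>f\<close>.\<close>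
  have "continuous_on T g"
    unfolding continuous_on_open_invariant openin_open[symmetric]
  proof (intro allI impI)
    fix B :: "real set" assume "open B"
    have "openin (top_of_set S) (S \<inter> f -` B)"
      using continuous_openin_preimage_gen[OF smooth_imp_continuous_on[OF f(1)] \<open>open B\<close>] .
    also have "S \<inter> f -` B = S \<inter> torus_param -` (T \<inter> g -` B)"
    proof (rule set_eqI)
      show "p \<in> S \<inter> f -` B \<longleftrightarrow> p \<in> S \<inter> torus_param -` (T \<inter> g -` B)" for p
        by (cases "p \<in> S") (simp_all add: g T_def)
    qed
    finally have "openin (top_of_set T) (T \<inter> g -` B)"
      using Abstract_Topology_2.continuous_imp_quotient_map[OF cont T_def[symmetric] \<open>compact S\<close>, of "T \<inter> g -` B"] by simp
    then show "\<exists>A. open A \<and> A \<inter> T = g -` B \<inter> T"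
      unfolding openin_open by (metis Int_commute)
  qed
  then obtain q where "real_polynomial_function q" "\<And>x. x \<in> T \<Longrightarrow> \<bar>g x - q x\<bar> < e"
    using Stone_Weierstrass_real_polynomial_function[OF \<open>compact T\<close> _ e] by blast
  then show ?thesis
    using g by (intro that[OF trig_poly_real_polynomial_function[of q]])
      (metis S_def T_def imageI)+
qed

text \<open>Orthogonality to all trigonometric polynomials \<open>q\<close> gives that the integral
  of f^2 equals that of f (f - q), and the second factor can be made uniformly small.\<close>

theorem fourier_uniqueness:
  fixes f :: "real \<times> real \<Rightarrow> real"
  assumes f: "smooth f" "periodic f"
    and zero: "\<And>m n c. torus_integral (\<lambda>p. f p * cos (phase m n c p)) = 0"
  shows "f = (\<lambda>p. 0)"
proof -
  let ?S = "cbox (0 :: real, 0 :: real) (2 * pi, 2 * pi)"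
  note smooth_intros[intro] integrable_smooth[intro]
  have orth: "torus_integral (\<lambda>p. f p * q p) = 0" if "trig_poly q" for q
    using that
  proof induction
    case (trig_poly_cos m n c)
    then show ?case by (rule zero)
  next
    case (trig_poly_add g h)
    then show ?case using f by (simp add: distrib_left torus_integral_add trig_poly_smooth smooth_mult)
  next
    case (trig_poly_cmult g r)
    then show ?case by (simp add: mult.left_commute[of _ r] torus_integral_cmult)
  qed
  have "bounded (f ` ?S)"
    using f by (intro compact_imp_bounded compact_continuous_image smooth_imp_continuous_on compact_cbox)
  then obtain B where "B > 0" and B: "\<And>p. p \<in> ?S \<Longrightarrow> \<bar>f p\<bar> \<le> B"
    unfolding bounded_pos by auto
  have le: "torus_integral (\<lambda>p. f p * f p) \<le> e" if "e > 0" for e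
  proof -
    \<comment> \<open>The torus has area pi^2 and |f| is at most \<open>B\<close> on the cell, so
      this tolerance bounds the integral of f (f - q) by \<open>e\<close>.\<close>
    obtain q where q: "trig_poly q" "\<And>p. p \<in> ?S \<Longrightarrow> \<bar>f p - q p\<bar> < e / (pi\<^sup>2 * B)"
      using trig_poly_approximation[OF f, of "e / (pi\<^sup>2 * B)"] \<open>e > 0\<close> \<open>B > 0\<close> by (metis divide_pos_pos mult_pos_pos pi_gt_zero zero_less_power)
    note sq = trig_poly_smooth[OF q(1)]
    have "torus_integral (\<lambda>p. f p * f p) = torus_integral (\<lambda>p. f p * (f p - q p))"
      using f sq orth[OF q(1)] by (simp add: right_diff_distrib torus_integral_diff smooth_mult)
    also have "\<dots> \<le> torus_integral (\<lambda>p. B * (e / (pi\<^sup>2 * B)))"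
      unfolding torus_integral_def
    proof (rule integral_le)
      fix p assume p: "p \<in> ?S"
      have "f p * (f p - q p) \<le> \<bar>f p\<bar> * \<bar>f p - q p\<bar>"
        by (metis abs_ge_self abs_mult)
      also have "\<dots> \<le> B * (e / (pi\<^sup>2 * B))"
        using B[OF p] q(2)[OF p] \<open>B > 0\<close> by (intro mult_mono) auto
      finally show "f p * (f p - q p) / 4 \<le> B * (e / (pi\<^sup>2 * B)) / 4" by simp
    next
      have "smooth (\<lambda>p. 1 / 4 * (f p * (f p - q p)))"
        using f sq by (intro smooth_intros)
      then show "(\<lambda>p. f p * (f p - q p) / 4) integrable_on ?S" by (intro integrable_smooth) simp
      show "(\<lambda>p. B * (e / (pi\<^sup>2 * B)) / 4) integrable_on ?S" by (rule integrable_const)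
    qed
    also have "\<dots> = e" using \<open>B > 0\<close> by (simp add: torus_integral_const)
    finally show ?thesis .
  qed
  have cont: "continuous_on ?S (\<lambda>p. f p * f p)"
    using f by (intro smooth_imp_continuous_on smooth_mult)
  have int: "(\<lambda>p. f p * f p) integrable_on ?S"
    using cont by (rule integrable_continuous)
  have "integral ?S (\<lambda>p. f p * f p) \<le> 0"
    using field_le_epsilon[of "torus_integral (\<lambda>p. f p * f p)" 0] le by (simp add: torus_integral_def)
  moreover have "integral ?S (\<lambda>p. f p * f p) \<ge> 0"
    using int by (intro integral_nonneg) auto
  ultimately have "((\<lambda>p. f p * f p) has_integral 0) ?S"
    using integrable_integral[OF int] by simp
  then have S0: "f p = 0" if "p \<in> ?S" for p
    using has_integral_0_cbox_imp_0[OF cont _ _ _ that] by (auto simp: box_ne_empty Basis_prod_def)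
  show ?thesis
    using torus_param_surj_cell periodic_eq_if_torus_param_eq[OF f(2)] S0 by metis
qed

text \<open>Left unnormalised, so that factors 1/pi^2 appear only in the expansion formulas. Varying
  \<open>c\<close> rotates the pair of cosine and sine coefficients of the mode.\<close>

definition fc :: "(real \<times> real \<Rightarrow> real) \<Rightarrow> int \<Rightarrow> int \<Rightarrow> real \<Rightarrow> real" where
  "fc f m n c = torus_integral (\<lambda>p. f p * cos (phase m n c p))"

definition fs :: "(real \<times> real \<Rightarrow> real) \<Rightarrow> int \<Rightarrow> int \<Rightarrow> real \<Rightarrow> real" where
  "fs f m n c = torus_integral (\<lambda>p. f p * sin (phase m n c p))"

lemma cos_sin_phase_0:
  "cos (phase m n c p) = cos c * cos (phase m n 0 p) - sin c * sin (phase m n 0 p)"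
  "sin (phase m n c p) = sin c * cos (phase m n 0 p) + cos c * sin (phase m n 0 p)"
  by (simp_all add: phase_def cos_add sin_add algebra_simps)

lemma fc_eq_0:
  assumes "smooth f"
  shows "fc f m n c = cos c * fc f m n 0 - sin c * fs f m n 0"
  unfolding fc_def fs_def cos_sin_phase_0(1)[of m n c]
  using assms by (simp add: right_diff_distrib mult.left_commute[of _ "cos c"] mult.left_commute[of _ "sin c"]
    torus_integral_diff torus_integral_cmult smooth_intros trig_intros del: cos_sin_phase_0)

lemma fc_fs_uminus: "fc f (- m) (- n) 0 = fc f m n 0" "fs f (- m) (- n) 0 = - fs f m n 0"
proof -
  have "phase (- m) (- n) 0 p = - phase m n 0 p" for p by (simp add: phase_def)
  then show "fc f (- m) (- n) 0 = fc f m n 0" "fs f (- m) (- n) 0 = - fs f m n 0"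
    by (simp_all add: fc_def fs_def torus_integral_minus)
qed

lemma fc_add: "smooth f \<Longrightarrow> smooth g \<Longrightarrow> fc (\<lambda>p. f p + g p) m n c = fc f m n c + fc g m n c"
  by (simp add: fc_def distrib_right torus_integral_add smooth_intros trig_intros)

lemma fc_diff: "smooth f \<Longrightarrow> smooth g \<Longrightarrow> fc (\<lambda>p. f p - g p) m n c = fc f m n c - fc g m n c"
  by (simp add: fc_def left_diff_distrib torus_integral_diff smooth_intros trig_intros)

lemma fc_cmult: "fc (\<lambda>p. r * f p) m n c = r * fc f m n c"
  by (simp add: fc_def mult.assoc torus_integral_cmult)

lemma fc_minus: "fc (\<lambda>p. - f p) m n c = - fc f m n c"
  by (simp add: fc_def torus_integral_minus)

lemma fs_add: "smooth f \<Longrightarrow> smooth g \<Longrightarrow> fs (\<lambda>p. f p + g p) m n c = fs f m n c + fs g m n c"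
  by (simp add: fs_def distrib_right torus_integral_add smooth_intros trig_intros)

lemma fs_diff: "smooth f \<Longrightarrow> smooth g \<Longrightarrow> fs (\<lambda>p. f p - g p) m n c = fs f m n c - fs g m n c"
  by (simp add: fs_def left_diff_distrib torus_integral_diff smooth_intros trig_intros)

lemma fs_cmult: "fs (\<lambda>p. r * f p) m n c = r * fs f m n c"
  by (simp add: fs_def mult.assoc torus_integral_cmult)

lemma fs_minus: "fs (\<lambda>p. - f p) m n c = - fs f m n c"
  by (simp add: fs_def torus_integral_minus)

text \<open>Integration by parts moves the derivative to the trigonometric factor. It exchanges
  \<open>fc\<close> and \<open>fs\<close> at the same phase, and the 2 is the coordinate length of
  the frame vectors.\<close>

lemma fc_frame_derivative:
  assumes "smooth f" "periodic f"
  shows "fc (diff f (2, 0)) m n c = 2 * real_of_int m * fs f m n c" "fc (diff f (0, 2)) m n c = 2 * real_of_int n * fs f m n c"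
    "fs (diff f (2, 0)) m n c = - (2 * real_of_int m * fc f m n c)" "fs (diff f (0, 2)) m n c = - (2 * real_of_int n * fc f m n c)"
proof -
  have *: "fc (diff f e) m n c = (m * fst e + n * snd e) * fs f m n c"
    "fs (diff f e) m n c = - ((m * fst e + n * snd e) * fc f m n c)" if "e \<in> frame" for e :: "real \<times> real"
    unfolding fc_def fs_def
    using torus_integral_by_parts[OF assms smooth_cos_phase periodic_sin_cos_phase(1) that]
      torus_integral_by_parts[OF assms smooth_sin_phase periodic_sin_cos_phase(2) that]
    by (simp_all add: diff_cos_phase diff_sin_phase mult.left_commute[of "f _"] torus_integral_cmult torus_integral_minus
      del: minus_add_distrib)
  show "fc (diff f (2, 0)) m n c = 2 * real_of_int m * fs f m n c" "fc (diff f (0, 2)) m n c = 2 * real_of_int n * fs f m n c"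
    "fs (diff f (2, 0)) m n c = - (2 * real_of_int m * fc f m n c)" "fs (diff f (0, 2)) m n c = - (2 * real_of_int n * fc f m n c)"
    using *[of "(2, 0)"] *[of "(0, 2)"] by (auto simp: frame_def)
qed

text \<open>Modes k and -k carry the same functions, hence two responses. At k = 0 both conditions
  hold and the two halves add up to the full area.\<close>

lemma fc_cos_phase: "fc (\<lambda>p. cos (phase (fst k) (snd k) c p)) m n c' = pi\<^sup>2 / 2 *
    ((if k = (- m, - n) then cos (c + c') else 0) + (if k = (m, n) then cos (c - c') else 0))"
  unfolding fc_def cos_phase_mult torus_integral_cmult
  by (subst torus_integral_add) (auto simp: smooth_cos_phase torus_integral_cos_phase prod_eq_iff algebra_simps)

text \<open>With finitely many modes there is no convergence question: the finite sum has the same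
  coefficients as \<open>f\<close>, and uniqueness applies. Since \<open>S\<close> is symmetric,
  each nonzero mode is counted twice, so 1/pi^2 is the right factor for these modes as well as for
  the zero mode.\<close>

theorem fourier_expansion:
  fixes f :: "real \<times> real \<Rightarrow> real"
  assumes f: "smooth f" "periodic f"
    and S: "finite S" "\<And>m n. (m, n) \<in> S \<Longrightarrow> (- m, - n) \<in> S"
    and zero: "\<And>m n c. (m, n) \<notin> S \<Longrightarrow> fc f m n c = 0"
  shows "f p = 1 / pi\<^sup>2 * (\<Sum>(m, n)\<in>S. fc f m n 0 * cos (phase m n 0 p) + fs f m n 0 * sin (phase m n 0 p))"
proof -
  define t where "t = (\<lambda>k p. fc f (fst k) (snd k) 0 * cos (phase (fst k) (snd k) 0 p) +
      fs f (fst k) (snd k) 0 * cos (phase (fst k) (snd k) (- (pi / 2)) p))"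
  define g where "g p = 1 / pi\<^sup>2 * (\<Sum>k\<in>S. t k p)" for p
  have st: "smooth (t k)" for k unfolding t_def by (intro smooth_intros trig_intros)
  have pt: "periodic (t k)" for k unfolding t_def by (intro periodic_intros trig_intros)
  have sg: "smooth g" unfolding g_def[abs_def] using st by (intro smooth_intros)
  have pg: "periodic g" unfolding g_def[abs_def] using pt by (simp add: periodic_def)
  have fc_sum: "fc (\<lambda>p. \<Sum>k\<in>K. t k p) m n c = (\<Sum>k\<in>K. fc (t k) m n c)" for K m n c
    using st by (induction K rule: infinite_finite_induct)
      (auto simp: fc_add smooth_sum fc_def[of "\<lambda>p. 0"] torus_integral_const)
  have t: "fc (t k) m n c = pi\<^sup>2 / 2 *
      ((if k = (- m, - n) then fc f (fst k) (snd k) 0 * cos c + fs f (fst k) (snd k) 0 * sin c else 0) +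
       (if k = (m, n) then fc f (fst k) (snd k) 0 * cos c - fs f (fst k) (snd k) 0 * sin c else 0))" for k m n c
    unfolding t_def
    by (simp add: fc_add fc_cmult fc_cos_phase smooth_intros trig_intros cos_add cos_diff)
      (auto simp: field_simps)
  have "fc g m n c = fc f m n c" for m n c
  proof (cases "(m, n) \<in> S")
    case True
    then have "(- m, - n) \<in> S" by (rule S)
    with True show ?thesis
      unfolding g_def fc_cmult fc_sum t sum_distrib_left[symmetric] sum.distrib
      by (simp add: S(1) fc_fs_uminus fc_eq_0[OF f(1), of m n c])
  next
    case False
    then have "(- m, - n) \<notin> S" using S(2) by force
    with False show ?thesis
      unfolding g_def fc_cmult fc_sum t sum_distrib_left[symmetric] sum.distrib
      by (simp add: S(1) zero)
  qed
  then have "(\<lambda>p. f p - g p) = (\<lambda>p. 0)"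
    using f sg pg by (intro fourier_uniqueness smooth_diff_fun periodic_intros)
      (auto simp: fc_def[symmetric] fc_diff)
  then have "f p = g p" by (metis eq_iff_diff_eq_0)
  then show ?thesis
    unfolding g_def t_def by (simp add: case_prod_beta sin_phase_eq)
qed

text \<open>One representative is kept of each pair k, -k in the square of modes with entries -1, 0,
  1; this doubles the factor of the nonzero modes.\<close>

lemma fourier_expansion_low_modes:
  fixes f :: "real \<times> real \<Rightarrow> real"
  assumes f: "smooth f" "periodic f"
    and zero: "\<And>m n c. 1 < \<bar>m\<bar> \<or> 1 < \<bar>n\<bar> \<Longrightarrow> fc f m n c = 0"
  shows "f p = 1 / pi\<^sup>2 * fc f 0 0 0 + 2 / pi\<^sup>2 *
    (\<Sum>(m, n)\<leftarrow>[(1, 0), (0, 1), (1, 1), (1, -1)].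
      fc f m n 0 * cos (phase m n 0 p) + fs f m n 0 * sin (phase m n 0 p))"
proof -
  have I: "{-1..1::int} = {-1, 0, 1}" by auto
  let ?t = "\<lambda>m n. fc f m n 0 * cos (phase m n 0 p) + fs f m n 0 * sin (phase m n 0 p)"
  have neg: "?t (- m) (- n) = ?t m n" for m n
  proof -
    have "phase (- m) (- n) 0 p = - phase m n 0 p" by (simp add: phase_def)
    then show ?thesis by (simp add: fc_fs_uminus)
  qed
  have "f p = 1 / pi\<^sup>2 * (\<Sum>(m, n)\<in>{-1..1} \<times> {-1..1}. ?t m n)"
    by (rule fourier_expansion[OF f]) (auto simp: not_le intro!: zero)
  also have "(\<Sum>(m, n)\<in>{-1..1} \<times> {-1..1}. ?t m n) = ?t 0 0 + 2 * (?t 1 0 + ?t 0 1 + ?t 1 1 + ?t 1 (-1))"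
    unfolding sum.cartesian_product[symmetric] I
    using neg[of 1 0] neg[of 0 1] neg[of 1 1] neg[of 1 "-1"] by simp
  also have "?t 0 0 = fc f 0 0 0" by (simp add: phase_def)
  finally show ?thesis by (simp add: algebra_simps)
qed

section \<open>The adapted frame\<close>

lemma UNIV_5: "(UNIV :: 5 set) = {1, 2, 3, 4, 5}"
proof -
  have "x \<in> {1, 2, 3, 4, 5}" for x :: 5
  proof (induct x)
    case (of_int z)
    then have "z = 0 \<or> z = 1 \<or> z = 2 \<or> z = 3 \<or> z = 4" by fastforce
    then show ?case by auto
  qed
  then show ?thesis by blast
qed

lemma forall_5: "(\<forall>i::5. P i) \<longleftrightarrow> P 1 \<and> P 2 \<and> P 3 \<and> P 4 \<and> P 5"
  unfolding ball_UNIV[of P, symmetric] UNIV_5 by simp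

lemma inner_5: "(x :: real^5) \<bullet> y = x $ 1 * y $ 1 + x $ 2 * y $ 2 + x $ 3 * y $ 3 + x $ 4 * y $ 4 + x $ 5 * y $ 5"
  unfolding inner_vec_def UNIV_5 by (simp add: ac_simps)

lemma smooth_vec:
  assumes "\<And>i. smooth (\<lambda>p. f p $ i :: real)"
  shows "smooth (f :: _ \<Rightarrow> real^'n)"
proof -
  have eq: "f = (\<lambda>p. \<Sum>i\<in>UNIV. f p $ i *\<^sub>R axis i 1)"
    by (rule ext) (simp add: basis_expansion flip: scalar_mult_eq_scaleR)
  show ?thesis
    by (subst eq) (intro smooth_sum smooth_scaleR smooth_const assms)
qed

lemma diff_vec_nth:
  assumes "smooth f"
  shows "diff f e p $ i = diff (\<lambda>p. f p $ i) e p"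
proof -
  have "((\<lambda>p. f p $ i) has_derivative (\<lambda>e. diff f e p $ i)) (at p)"
    by (rule bounded_linear.has_derivative[OF bounded_linear_vec_nth has_derivative_diff[OF assms]])
  then show ?thesis by (simp add: diff_eq)
qed

definition tang1 :: "real \<times> real \<Rightarrow> real^5" where
  "tang1 p = vector [- sin (fst p), cos (fst p), 0, 0, 0]"

definition tang2 :: "real \<times> real \<Rightarrow> real^5" where
  "tang2 p = vector [0, 0, - sin (snd p), cos (snd p), 0]"

text \<open>The normal of the torus inside the small hypersphere x_5 = 1/sqrt 2. It has squared
  length 2; leaving it unnormalised keeps the structure equations free of square roots.\<close>

definition norm1 :: "real \<times> real \<Rightarrow> real^5" where
  "norm1 p = vector [cos (fst p), sin (fst p), - cos (snd p), - sin (snd p), 0]"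

text \<open>The unit normal of the small hypersphere x_5 = 1/sqrt 2 in the sphere; it turns out to
  be half the tension field.\<close>

definition norm2 :: "real \<times> real \<Rightarrow> real^5" where
  "norm2 p = vector [- (1 / 2 * cos (fst p)), - (1 / 2 * sin (fst p)),
     - (1 / 2 * cos (snd p)), - (1 / 2 * sin (snd p)), 1 / sqrt 2]"

lemma Phi_eq: "Phi p = vector [1 / 2 * cos (fst p), 1 / 2 * sin (fst p),
     1 / 2 * cos (snd p), 1 / 2 * sin (snd p), 1 / sqrt 2]"
  by (simp add: Phi_def case_prod_beta)

lemmas frame_defs = tang1_def tang2_def norm1_def norm2_def Phi_eq

lemma smooth_cos_sin_coordinate:
  "smooth (\<lambda>p. cos (fst p :: real))" "smooth (\<lambda>p. sin (fst p :: real))"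
  "smooth (\<lambda>p. cos (snd p :: real))" "smooth (\<lambda>p. sin (snd p :: real))"
  using smooth_cos_linear[OF bounded_linear_fst, of 0] smooth_cos_linear[OF bounded_linear_snd, of 0]
    smooth_cos_linear[OF bounded_linear_fst, of "- (pi / 2)"] smooth_cos_linear[OF bounded_linear_snd, of "- (pi / 2)"]
  by (simp_all add: cos_diff)

lemma diff_cos_sin_coordinate:
  "diff (\<lambda>p. cos (fst p)) e p = - (fst e * sin (fst p))"
  "diff (\<lambda>p. sin (fst p)) e p = fst e * cos (fst p)"
  "diff (\<lambda>p. cos (snd p)) e p = - (snd e * sin (snd p))"
  "diff (\<lambda>p. sin (snd p)) e p = snd e * cos (snd p)"
proof -
  have "((\<lambda>p. cos (fst p)) has_derivative (\<lambda>e. - (fst e * sin (fst p)))) (at p)"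
    "((\<lambda>p. sin (fst p)) has_derivative (\<lambda>e. fst e * cos (fst p))) (at p)"
    "((\<lambda>p. cos (snd p)) has_derivative (\<lambda>e. - (snd e * sin (snd p)))) (at p)"
    "((\<lambda>p. sin (snd p)) has_derivative (\<lambda>e. snd e * cos (snd p))) (at p)"
    by (auto intro!: derivative_eq_intros simp: fun_eq_iff)
  from this[THEN diff_eq] show "diff (\<lambda>p. cos (fst p)) e p = - (fst e * sin (fst p))"
    "diff (\<lambda>p. sin (fst p)) e p = fst e * cos (fst p)"
    "diff (\<lambda>p. cos (snd p)) e p = - (snd e * sin (snd p))"
    "diff (\<lambda>p. sin (snd p)) e p = snd e * cos (snd p)" .
qed

lemma smooth_frame: "smooth tang1" "smooth tang2" "smooth norm1" "smooth norm2" "smooth Phi"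
proof -
  have *: "smooth f" if "\<forall>i::5. smooth (\<lambda>p. f p $ i :: real)" for f :: "real \<times> real \<Rightarrow> real^5"
    using that smooth_vec by blast
  note s = smooth_cos_sin_coordinate smooth_intros
  show "smooth tang1" "smooth tang2" "smooth norm1" "smooth norm2" "smooth Phi"
    by (rule *, unfold forall_5 frame_defs vector_5, intro conjI s)+
qed

lemma periodic_frame: "periodic tang1" "periodic tang2" "periodic norm1" "periodic norm2" "periodic Phi"
  by (simp_all add: periodic_def frame_defs)

lemma inner_frame:
  "tang1 p \<bullet> tang1 p = 1" "tang1 p \<bullet> tang2 p = 0" "tang1 p \<bullet> norm1 p = 0" "tang1 p \<bullet> norm2 p = 0" "tang1 p \<bullet> Phi p = 0"
  "tang2 p \<bullet> tang1 p = 0" "tang2 p \<bullet> tang2 p = 1" "tang2 p \<bullet> norm1 p = 0" "tang2 p \<bullet> norm2 p = 0" "tang2 p \<bullet> Phi p = 0"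
  "norm1 p \<bullet> tang1 p = 0" "norm1 p \<bullet> tang2 p = 0" "norm1 p \<bullet> norm1 p = 2" "norm1 p \<bullet> norm2 p = 0" "norm1 p \<bullet> Phi p = 0"
  "norm2 p \<bullet> tang1 p = 0" "norm2 p \<bullet> tang2 p = 0" "norm2 p \<bullet> norm1 p = 0" "norm2 p \<bullet> norm2 p = 1" "norm2 p \<bullet> Phi p = 0"
  "Phi p \<bullet> tang1 p = 0" "Phi p \<bullet> tang2 p = 0" "Phi p \<bullet> norm1 p = 0" "Phi p \<bullet> norm2 p = 0" "Phi p \<bullet> Phi p = 1"
  by (simp_all add: inner_5 frame_defs vector_5 flip: power2_eq_square)
    (simp_all add: power_mult_distrib power_divide cos_squared_eq diff_divide_distrib)

text \<open>The Gauss and Weingarten formulas of the immersion, with the ambient terms along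
  \<open>Phi\<close> that \<open>nabla\<close> projects away.\<close>

lemma diff_frame:
  "diff Phi (2, 0) = tang1" "diff Phi (0, 2) = tang2"
  "diff tang1 (2, 0) = (\<lambda>p. norm2 p - norm1 p - Phi p)" "diff tang1 (0, 2) = (\<lambda>p. 0)"
  "diff tang2 (2, 0) = (\<lambda>p. 0)" "diff tang2 (0, 2) = (\<lambda>p. norm2 p + norm1 p - Phi p)"
  "diff norm1 (2, 0) = (\<lambda>p. 2 *\<^sub>R tang1 p)" "diff norm1 (0, 2) = (\<lambda>p. - (2 *\<^sub>R tang2 p))"
  "diff norm2 (2, 0) = (\<lambda>p. - tang1 p)" "diff norm2 (0, 2) = (\<lambda>p. - tang2 p)"
  unfolding fun_eq_iff vec_eq_iff forall_5
  by (simp_all add: diff_vec_nth smooth_frame)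
    (simp_all add: frame_defs vector_5 diff_rules smooth_intros smooth_cos_sin_coordinate diff_cos_sin_coordinate)

definition frame_section :: "(real \<times> real \<Rightarrow> real) \<Rightarrow> (real \<times> real \<Rightarrow> real) \<Rightarrow> (real \<times> real \<Rightarrow> real)
    \<Rightarrow> (real \<times> real \<Rightarrow> real) \<Rightarrow> real \<times> real \<Rightarrow> real^5" where
  "frame_section x y g h p = x p *\<^sub>R tang1 p + y p *\<^sub>R tang2 p + g p *\<^sub>R norm1 p + h p *\<^sub>R norm2 p"

lemma smooth_frame_section:
  "smooth x \<Longrightarrow> smooth y \<Longrightarrow> smooth g \<Longrightarrow> smooth h \<Longrightarrow> smooth (frame_section x y g h)"
  unfolding frame_section_def[abs_def] by (intro smooth_intros smooth_frame)

lemma inner_frame_section: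
  "frame_section x y g h p \<bullet> tang1 p = x p" "frame_section x y g h p \<bullet> tang2 p = y p"
  "frame_section x y g h p \<bullet> norm1 p = 2 * g p" "frame_section x y g h p \<bullet> norm2 p = h p"
  "frame_section x y g h p \<bullet> Phi p = 0"
  by (simp_all add: frame_section_def inner_add_left inner_frame)

lemma frame_section_eq_iff:
  "frame_section x y g h p = frame_section x' y' g' h' p \<longleftrightarrow> x p = x' p \<and> y p = y' p \<and> g p = g' p \<and> h p = h' p"
  (is "?l = ?r \<longleftrightarrow> _")
proof
  assume "?l = ?r"
  then have "?l \<bullet> v = ?r \<bullet> v" for v by simp
  from this[of "tang1 p"] this[of "tang2 p"] this[of "norm1 p"] this[of "norm2 p"]
  show "x p = x' p \<and> y p = y' p \<and> g p = g' p \<and> h p = h' p"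
    by (simp add: inner_frame_section)
qed (simp add: frame_section_def)

lemma frame_section_in_sections:
  assumes "smooth x" "smooth y" "smooth g" "smooth h" "periodic x" "periodic y" "periodic g" "periodic h"
  shows "frame_section x y g h \<in> sections Phi"
proof -
  have "periodic (frame_section x y g h)"
    unfolding frame_section_def[abs_def] by (intro periodic_intros periodic_frame assms)
  then show ?thesis
    using assms by (simp add: sections_def smooth_frame_section inner_frame_section)
qed

text \<open>The frame and \<open>Phi\<close> form an orthogonal basis of R^5, so the remainder
  \<open>w\<close>, orthogonal to all five vectors, must vanish.\<close>

lemma frame_expansion:
  assumes "v \<bullet> Phi p = 0"
  shows "v = (v \<bullet> tang1 p) *\<^sub>R tang1 p + (v \<bullet> tang2 p) *\<^sub>R tang2 p
    + (v \<bullet> norm1 p / 2) *\<^sub>R norm1 p + (v \<bullet> norm2 p) *\<^sub>R norm2 p"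
proof -
  define w where "w = v - ((v \<bullet> tang1 p) *\<^sub>R tang1 p + (v \<bullet> tang2 p) *\<^sub>R tang2 p
    + (v \<bullet> norm1 p / 2) *\<^sub>R norm1 p + (v \<bullet> norm2 p) *\<^sub>R norm2 p)"
  have "w \<bullet> tang1 p = 0" "w \<bullet> tang2 p = 0" "w \<bullet> norm1 p = 0" "w \<bullet> norm2 p = 0" "w \<bullet> Phi p = 0"
    using assms by (simp_all add: w_def inner_diff_left inner_add_left inner_frame)
  \<comment> \<open>\<open>Phi p + norm2 p\<close> is a multiple of the fifth basis vector and
    \<open>Phi p - norm2 p\<close> has no fifth coordinate, which separates \<open>w $ 5\<close>
    from the two planes.\<close>
  then have t: "- w $ 1 * sin (fst p) + w $ 2 * cos (fst p) = 0" "- w $ 3 * sin (snd p) + w $ 4 * cos (snd p) = 0"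
    and n: "w \<bullet> norm1 p = 0" "w \<bullet> (Phi p - norm2 p) = 0" "w \<bullet> (Phi p + norm2 p) = 0"
    unfolding inner_diff_right inner_add_right by (simp_all add: inner_5 frame_defs vector_5)
  from n have "w $ 1 * cos (fst p) + w $ 2 * sin (fst p) = w $ 3 * cos (snd p) + w $ 4 * sin (snd p)"
    "w $ 1 * cos (fst p) + w $ 2 * sin (fst p) + (w $ 3 * cos (snd p) + w $ 4 * sin (snd p)) = 0" and 5: "w $ 5 = 0"
    by (simp_all add: inner_5 norm1_def norm2_def Phi_eq vector_5)
  then have r: "w $ 1 * cos (fst p) + w $ 2 * sin (fst p) = 0" "w $ 3 * cos (snd p) + w $ 4 * sin (snd p) = 0"
    by linarith+
  \<comment> \<open>The two expressions are the coordinates of (a, b) in a rotated orthonormal basis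
    of the plane.\<close>
  have *: "a = 0 \<and> b = 0" if "- a * sin x + b * cos x = 0" "a * cos x + b * sin x = 0" for a b x :: real
  proof -
    have "a * (s * s + c * c) = c * (a * c + b * s) - s * (- a * s + b * c)"
      "b * (s * s + c * c) = s * (a * c + b * s) + c * (- a * s + b * c)" for s c
      by (simp_all add: algebra_simps)
    from this[of "sin x" "cos x"] show ?thesis
      unfolding that sin_cos_squared_add3 by (simp add: add.commute[of "sin x * sin x"] sin_cos_squared_add3)
  qed
  have "w = 0" using *[OF t(1) r(1)] *[OF t(2) r(2)] 5 by (simp add: vec_eq_iff forall_5)
  then show ?thesis by (simp add: w_def)
qed

lemma sections_frame_section:
  assumes "V \<in> sections Phi"
  obtains x y g h where "smooth x" "smooth y" "smooth g" "smooth h"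
    "periodic x" "periodic y" "periodic g" "periodic h" "V = frame_section x y g h"
proof
  let ?g = "\<lambda>p. V p \<bullet> norm1 p / 2"
  have V: "smooth V" "periodic V" "\<And>p. V p \<bullet> Phi p = 0" using assms by (auto simp: sections_def)
  show "smooth (\<lambda>p. V p \<bullet> tang1 p)" "smooth (\<lambda>p. V p \<bullet> tang2 p)" "smooth ?g" "smooth (\<lambda>p. V p \<bullet> norm2 p)"
    by (intro smooth_intros smooth_frame V)+
  show "periodic (\<lambda>p. V p \<bullet> tang1 p)" "periodic (\<lambda>p. V p \<bullet> tang2 p)" "periodic ?g" "periodic (\<lambda>p. V p \<bullet> norm2 p)"
    by (intro periodic_intros periodic_frame V)+
  show "V = frame_section (\<lambda>p. V p \<bullet> tang1 p) (\<lambda>p. V p \<bullet> tang2 p) ?g (\<lambda>p. V p \<bullet> norm2 p)"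
    by (rule ext) (unfold frame_section_def, rule frame_expansion[OF V(3)])
qed

section \<open>The Jacobi operator in the adapted frame\<close>

abbreviation d1 :: "(real \<times> real \<Rightarrow> real) \<Rightarrow> real \<times> real \<Rightarrow> real" where
  "d1 f \<equiv> diff f (2, 0)"

abbreviation d2 :: "(real \<times> real \<Rightarrow> real) \<Rightarrow> real \<times> real \<Rightarrow> real" where
  "d2 f \<equiv> diff f (0, 2)"

lemma diff_frame_section:
  assumes "smooth x" "smooth y" "smooth g" "smooth h"
  shows "diff (frame_section x y g h) (2, 0) p = frame_section
      (\<lambda>p. d1 x p + 2 * g p - h p) (d1 y) (\<lambda>p. d1 g p - x p) (\<lambda>p. d1 h p + x p) p - x p *\<^sub>R Phi p"
    "diff (frame_section x y g h) (0, 2) p = frame_section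
      (d2 x) (\<lambda>p. d2 y p - 2 * g p - h p) (\<lambda>p. d2 g p + y p) (\<lambda>p. d2 h p + y p) p - y p *\<^sub>R Phi p"
  unfolding frame_section_def[abs_def]
  using assms by (simp_all add: diff_rules smooth_intros smooth_frame diff_frame algebra_simps)

lemma nabla_frame_section:
  assumes "smooth x" "smooth y" "smooth g" "smooth h"
  shows "nabla Phi (2, 0) (frame_section x y g h) =
      frame_section (\<lambda>p. d1 x p + 2 * g p - h p) (d1 y) (\<lambda>p. d1 g p - x p) (\<lambda>p. d1 h p + x p)"
    "nabla Phi (0, 2) (frame_section x y g h) =
      frame_section (d2 x) (\<lambda>p. d2 y p - 2 * g p - h p) (\<lambda>p. d2 g p + y p) (\<lambda>p. d2 h p + y p)"
  unfolding nabla_def fun_eq_iff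
  by (simp_all add: diff_frame_section[OF assms] inner_diff_left inner_frame_section inner_frame)

lemma frame_section_add: "frame_section x y g h p + frame_section x' y' g' h' p =
    frame_section (\<lambda>p. x p + x' p) (\<lambda>p. y p + y' p) (\<lambda>p. g p + g' p) (\<lambda>p. h p + h' p) p"
  by (simp add: frame_section_def algebra_simps)

lemma frame_section_scaleR: "c *\<^sub>R frame_section x y g h p =
    frame_section (\<lambda>p. c * x p) (\<lambda>p. c * y p) (\<lambda>p. c * g p) (\<lambda>p. c * h p) p"
  by (simp add: frame_section_def algebra_simps)

lemma frame_section_minus: "- frame_section x y g h p =
    frame_section (\<lambda>p. - x p) (\<lambda>p. - y p) (\<lambda>p. - g p) (\<lambda>p. - h p) p"
  by (simp add: frame_section_def)

lemma frame_section_diff: "frame_section x y g h p - frame_section x' y' g' h' p =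
    frame_section (\<lambda>p. x p - x' p) (\<lambda>p. y p - y' p) (\<lambda>p. g p - g' p) (\<lambda>p. h p - h' p) p"
  by (simp add: frame_section_def algebra_simps)

lemma tang_norm_frame_section:
  "tang1 p = frame_section (\<lambda>p. 1) (\<lambda>p. 0) (\<lambda>p. 0) (\<lambda>p. 0) p"
  "tang2 p = frame_section (\<lambda>p. 0) (\<lambda>p. 1) (\<lambda>p. 0) (\<lambda>p. 0) p"
  "norm2 p = frame_section (\<lambda>p. 0) (\<lambda>p. 0) (\<lambda>p. 0) (\<lambda>p. 1) p"
  by (simp_all add: frame_section_def)

lemmas frame_section_algebra = frame_section_add frame_section_scaleR frame_section_minus
  frame_section_diff

lemma sum_frame: "(\<Sum>e\<in>frame. F e) = F (2, 0) + F (0, 2)"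
  by (simp add: frame_def)

definition lap :: "(real \<times> real \<Rightarrow> real) \<Rightarrow> real \<times> real \<Rightarrow> real" where
  "lap f p = - d1 (d1 f) p - d2 (d2 f) p"

lemma smooth_lap: "smooth f \<Longrightarrow> smooth (lap f)"
  unfolding lap_def[abs_def] by (intro smooth_intros)

lemma periodic_lap: "smooth f \<Longrightarrow> periodic f \<Longrightarrow> periodic (lap f)"
  unfolding lap_def[abs_def] by (intro periodic_intros smooth_intros)

lemma lap_minus: "smooth f \<Longrightarrow> lap (\<lambda>p. - f p) = (\<lambda>p. - lap f p)"
  by (simp add: lap_def[abs_def] diff_rules smooth_intros algebra_simps)

lemma lap_cmult: "smooth f \<Longrightarrow> lap (\<lambda>p. c * f p) = (\<lambda>p. c * lap f p)"
  by (simp add: lap_def[abs_def] diff_rules smooth_intros algebra_simps)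

lemma rough_laplacian_frame_section:
  assumes "smooth x" "smooth y" "smooth g" "smooth h"
  shows "rough_laplacian Phi (frame_section x y g h) = frame_section
      (\<lambda>p. lap x p + 3 * x p - 4 * d1 g p + 2 * d1 h p)
      (\<lambda>p. lap y p + 3 * y p + 4 * d2 g p + 2 * d2 h p)
      (\<lambda>p. lap g p + 4 * g p + 2 * d1 x p - 2 * d2 y p)
      (\<lambda>p. lap h p + 2 * h p - 2 * d1 x p - 2 * d2 y p)"
  unfolding rough_laplacian_def[abs_def] sum_frame
  using assms
  by (simp add: nabla_frame_section smooth_intros diff_rules)
    (simp add: fun_eq_iff frame_section_algebra frame_section_eq_iff lap_def)

lemma tension_Phi: "tension Phi = frame_section (\<lambda>p. 0) (\<lambda>p. 0) (\<lambda>p. 0) (\<lambda>p. 2)"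
proof -
  have "diff Phi (2, 0) = frame_section (\<lambda>p. 1) (\<lambda>p. 0) (\<lambda>p. 0) (\<lambda>p. 0)"
    "diff Phi (0, 2) = frame_section (\<lambda>p. 0) (\<lambda>p. 1) (\<lambda>p. 0) (\<lambda>p. 0)"
    by (auto simp: diff_frame tang_norm_frame_section)
  then show ?thesis
    unfolding tension_def[abs_def] sum_frame
    by (simp add: nabla_frame_section smooth_const diff_const)
      (simp add: fun_eq_iff frame_section_algebra)
qed

lemma diff_norm_sq_Phi: "diff_norm_sq Phi p = 2"
  unfolding diff_norm_sq_def sum_frame by (simp add: diff_frame power2_norm_eq_inner inner_frame)

text \<open>The components of the rough Laplacian enter as named parameters \<open>lx\<close>,
  \<open>ly\<close>, \<open>lg\<close>, \<open>lh\<close>. The fourth-order expression then stays a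
  second-order one in them, and the Fourier computation can proceed in the same two stages.\<close>

lemma jacobi2_frame_section:
  fixes x y g h :: "real \<times> real \<Rightarrow> real"
  assumes [simp]: "smooth x" "smooth y" "smooth g" "smooth h"
    and lx_def: "lx = (\<lambda>p. lap x p + 3 * x p - 4 * d1 g p + 2 * d1 h p)"
    and ly_def: "ly = (\<lambda>p. lap y p + 3 * y p + 4 * d2 g p + 2 * d2 h p)"
    and lg_def: "lg = (\<lambda>p. lap g p + 4 * g p + 2 * d1 x p - 2 * d2 y p)"
    and lh_def: "lh = (\<lambda>p. lap h p + 2 * h p - 2 * d1 x p - 2 * d2 y p)"
  shows "jacobi2 Phi (frame_section x y g h) = frame_section
      (\<lambda>p. lap lx p + 3 * lx p - 4 * d1 lg p + 2 * d1 lh p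
        - lap x p - 3 * x p + 8 * d1 g p - 4 * d1 h p - lx p - 3 * x p - 4 * d1 h p)
      (\<lambda>p. lap ly p + 3 * ly p + 4 * d2 lg p + 2 * d2 lh p
        - lap y p - 3 * y p - 8 * d2 g p - 4 * d2 h p - ly p - 3 * y p - 4 * d2 h p)
      (\<lambda>p. lap lg p + 4 * lg p + 2 * d1 lx p - 2 * d2 ly p
        - 2 * lap g p - 8 * g p - 2 * d1 x p + 2 * d2 y p - 2 * lg p)
      (\<lambda>p. lap lh p + 2 * lh p - 2 * d1 lx p - 2 * d2 ly p
        - 2 * lap h p - 4 * h p + 2 * d1 x p + 2 * d2 y p - 2 * lh p - 12 * h p + 4 * d1 x p + 4 * d2 y p)"
proof
  fix p
  have [simp]: "smooth lx" "smooth ly" "smooth lg" "smooth lh"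
    unfolding lx_def ly_def lg_def lh_def by (intro smooth_intros smooth_lap assms(1-4))+
  have L: "rough_laplacian Phi (frame_section x y g h) = frame_section lx ly lg lh"
    unfolding lx_def ly_def lg_def lh_def by (rule rough_laplacian_frame_section) simp_all
  have LL: "rough_laplacian Phi (frame_section lx ly lg lh) = frame_section
      (\<lambda>p. lap lx p + 3 * lx p - 4 * d1 lg p + 2 * d1 lh p)
      (\<lambda>p. lap ly p + 3 * ly p + 4 * d2 lg p + 2 * d2 lh p)
      (\<lambda>p. lap lg p + 4 * lg p + 2 * d1 lx p - 2 * d2 ly p)
      (\<lambda>p. lap lh p + 2 * lh p - 2 * d1 lx p - 2 * d2 ly p)"
    by (rule rough_laplacian_frame_section) simp_all
  \<comment> \<open>The sum over the frame is the tangential projection, which keeps x and y and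
    drops g and h; subtracting |dPhi|^2 = 2 times the section leaves the factors -1 and -2.\<close>
  have T: "(\<lambda>q. (\<Sum>e\<in>frame. (frame_section x y g h q \<bullet> diff Phi e q) *\<^sub>R diff Phi e q)
        - diff_norm_sq Phi q *\<^sub>R frame_section x y g h q)
      = frame_section (\<lambda>p. - x p) (\<lambda>p. - y p) (\<lambda>p. - (2 * g p)) (\<lambda>p. - (2 * h p))"
    unfolding sum_frame diff_norm_sq_Phi diff_frame inner_frame_section
    by (simp add: fun_eq_iff tang_norm_frame_section frame_section_algebra frame_section_eq_iff)
  have LT: "rough_laplacian Phi (frame_section (\<lambda>p. - x p) (\<lambda>p. - y p) (\<lambda>p. - (2 * g p)) (\<lambda>p. - (2 * h p)))
      = frame_section
      (\<lambda>p. - lap x p - 3 * x p + 8 * d1 g p - 4 * d1 h p)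
      (\<lambda>p. - lap y p - 3 * y p - 8 * d2 g p - 4 * d2 h p)
      (\<lambda>p. - 2 * lap g p - 8 * g p - 2 * d1 x p + 2 * d2 y p)
      (\<lambda>p. - 2 * lap h p - 4 * h p + 2 * d1 x p + 2 * d2 y p)"
    by (subst rough_laplacian_frame_section) (simp_all add: smooth_intros diff_rules lap_minus lap_cmult)
  have t: "nabla Phi (2, 0) (tension Phi) = (\<lambda>p. - (2 *\<^sub>R tang1 p))"
    "nabla Phi (0, 2) (tension Phi) = (\<lambda>p. - (2 *\<^sub>R tang2 p))"
    by (simp_all add: tension_Phi nabla_frame_section smooth_const diff_const fun_eq_iff)
      (simp_all add: frame_section_def)
  have t2: "tension Phi p = 2 *\<^sub>R norm2 p" by (simp add: tension_Phi frame_section_def)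
  have n: "(norm (2 *\<^sub>R norm2 p))\<^sup>2 = 4" by (simp add: power2_norm_eq_inner inner_frame)
  have c: "norm2 p \<bullet> V = V \<bullet> norm2 p" "tang1 p \<bullet> V = V \<bullet> tang1 p" "tang2 p \<bullet> V = V \<bullet> tang2 p" for V
    by (simp_all add: inner_commute)
  show "jacobi2 Phi (frame_section x y g h) p = frame_section
      (\<lambda>p. lap lx p + 3 * lx p - 4 * d1 lg p + 2 * d1 lh p
        - lap x p - 3 * x p + 8 * d1 g p - 4 * d1 h p - lx p - 3 * x p - 4 * d1 h p)
      (\<lambda>p. lap ly p + 3 * ly p + 4 * d2 lg p + 2 * d2 lh p
        - lap y p - 3 * y p - 8 * d2 g p - 4 * d2 h p - ly p - 3 * y p - 4 * d2 h p)
      (\<lambda>p. lap lg p + 4 * lg p + 2 * d1 lx p - 2 * d2 ly p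
        - 2 * lap g p - 8 * g p - 2 * d1 x p + 2 * d2 y p - 2 * lg p)
      (\<lambda>p. lap lh p + 2 * lh p - 2 * d1 lx p - 2 * d2 ly p
        - 2 * lap h p - 4 * h p + 2 * d1 x p + 2 * d2 y p - 2 * lh p - 12 * h p + 4 * d1 x p + 4 * d2 y p) p"
    unfolding jacobi2_def L LL T LT
    unfolding sum_frame t t2 n diff_norm_sq_Phi diff_frame
      nabla_frame_section[OF assms(1-4)] inner_scaleR_left inner_scaleR_right inner_minus_right
      inner_minus_left c inner_frame inner_frame_section
    unfolding tang_norm_frame_section frame_section_algebra frame_section_eq_iff
    by (simp add: algebra_simps)
qed

section \<open>First variation of the bienergy\<close>

lemma times_differentiable_compose_linear:
  assumes "bounded_linear l" "times_differentiable k f"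
  shows "times_differentiable k (\<lambda>x. f (l x))"
  using assms(2)
proof (induction k arbitrary: f)
  case 0
  have "continuous_on UNIV (f \<circ> l)"
    using 0 by (intro continuous_on_compose linear_continuous_on[OF assms(1)])
      (auto intro: continuous_on_subset)
  then show ?case by (simp add: o_def)
next
  case (Suc k)
  have "((\<lambda>x. f (l x)) has_derivative (\<lambda>v. frechet_derivative f (at (l x)) (l v))) (at x)" for x
    using Suc.prems
    by (intro has_derivative_compose[OF bounded_linear_imp_has_derivative[OF assms(1)]])
      (auto simp: frechet_derivative_works)
  note * = this frechet_derivative_at[OF this, symmetric]
  show ?case
    unfolding times_differentiable.simps *(2)
    using Suc.IH[of "\<lambda>x. frechet_derivative f (at x) (l v)" for v] Suc.prems *(1)
    by (auto simp: differentiable_def)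
qed

lemma smooth_compose_linear: "bounded_linear l \<Longrightarrow> smooth f \<Longrightarrow> smooth (\<lambda>x. f (l x))"
  by (simp add: smooth_def times_differentiable_compose_linear)

text \<open>Writes spatial derivatives of a variation as slices of a jointly smooth function of (t,
  p), so that the step can be iterated and then differentiated in t.\<close>

lemma diff_slice:
  fixes G :: "real \<times> (real \<times> real) \<Rightarrow> 'a::euclidean_space"
  assumes "smooth G"
  shows "diff (\<lambda>p. G (t, p)) e = (\<lambda>p. frechet_derivative G (at (t, p)) (0, e))"
proof
  fix p :: "real \<times> real"
  have "((\<lambda>p. (t, p)) has_derivative (\<lambda>e. (0, e))) (at p)"
    by (auto intro!: derivative_eq_intros)
  from has_derivative_compose[where f = "\<lambda>p. (t, p)" and g = G, OF this smooth_has_derivative[OF assms]]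
  show "diff (\<lambda>p. G (t, p)) e p = frechet_derivative G (at (t, p)) (0, e)"
    by (rule diff_eq)
qed

lemma has_derivative_torus_integral:
  fixes Q :: "real \<times> (real \<times> real) \<Rightarrow> real"
  assumes "smooth Q"
  shows "((\<lambda>t. torus_integral (\<lambda>p. Q (t, p))) has_real_derivative
    torus_integral (\<lambda>p. frechet_derivative Q (at (t, p)) (1, 0))) (at t)"
proof -
  let ?Q' = "\<lambda>z. frechet_derivative Q (at z) (1, 0)"
  have Q': "smooth ?Q'" by (rule smooth_frechet_derivative[OF assms])
  have "((\<lambda>t. integral (cbox (0, 0) (2 * pi, 2 * pi)) (\<lambda>p. Q (t, p) / 4)) has_field_derivative
      integral (cbox (0, 0) (2 * pi, 2 * pi)) (\<lambda>p. ?Q' (t, p) / 4)) (at t within UNIV)"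
  proof (rule leibniz_rule_field_derivative)
    fix t :: real and p :: "real \<times> real"
    have "((\<lambda>t. (t, p)) has_derivative (\<lambda>s. (s, 0))) (at t)"
      by (auto intro!: derivative_eq_intros)
    from has_derivative_compose[where f = "\<lambda>t. (t, p)" and g = Q, OF this smooth_has_derivative[OF assms]]
    have "((\<lambda>t. Q (t, p)) has_derivative (\<lambda>s. frechet_derivative Q (at (t, p)) (s, 0))) (at t)" .
    moreover have "(\<lambda>s. frechet_derivative Q (at (t, p)) (s, 0)) = (*) (?Q' (t, p))"
    proof
      fix s
      show "frechet_derivative Q (at (t, p)) (s, 0) = ?Q' (t, p) * s"
        using linear_scale[OF has_derivative_linear[OF smooth_has_derivative[OF assms]], of "(t, p)" s "(1, 0)"]
        by simp
    qed
    ultimately have "((\<lambda>t. Q (t, p)) has_field_derivative ?Q' (t, p)) (at t)"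
      unfolding has_field_derivative_def by (simp only:)
    then show "((\<lambda>t. Q (t, p) / 4) has_field_derivative ?Q' (t, p) / 4) (at t within UNIV)"
      by (auto intro!: derivative_eq_intros)
  next
    fix t
    have "continuous_on (cbox (0, 0) (2 * pi, 2 * pi)) (\<lambda>p. Q (t, p))"
      by (rule continuous_on_compose2[OF smooth_imp_continuous_on[OF assms, of UNIV]])
        (auto intro!: continuous_intros)
    then show "(\<lambda>p. Q (t, p) / 4) integrable_on cbox (0, 0) (2 * pi, 2 * pi)"
      by (intro integrable_continuous continuous_intros) auto
  next
    have "continuous_on (UNIV \<times> cbox (0, 0) (2 * pi, 2 * pi)) (\<lambda>z. ?Q' z / 4)"
      by (intro continuous_intros smooth_imp_continuous_on Q') auto
    then show "continuous_on (UNIV \<times> cbox (0, 0) (2 * pi, 2 * pi)) (\<lambda>(t, p). ?Q' (t, p) / 4)"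
      by (simp add: case_prod_beta)
  qed auto
  then show ?thesis by (simp add: torus_integral_def)
qed

text \<open>The Laplacian in the ambient Euclidean space, with the sign opposite to
  \<open>lap\<close>: the tension field is its tangential part.\<close>

definition vlap :: "(real \<times> real \<Rightarrow> 'a::euclidean_space) \<Rightarrow> real \<times> real \<Rightarrow> 'a" where
  "vlap f p = diff (diff f (2, 0)) (2, 0) p + diff (diff f (0, 2)) (0, 2) p"

lemma smooth_vlap: "smooth f \<Longrightarrow> smooth (vlap f)"
  unfolding vlap_def[abs_def] by (intro smooth_intros)

lemma torus_integral_vlap:
  fixes f g :: "real \<times> real \<Rightarrow> 'a::euclidean_space"
  assumes "smooth f" "periodic f" "smooth g" "periodic g"
  shows "torus_integral (\<lambda>p. vlap f p \<bullet> g p) = torus_integral (\<lambda>p. f p \<bullet> vlap g p)"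
proof -
  have *: "torus_integral (\<lambda>p. diff (diff f e) e p \<bullet> g p) = torus_integral (\<lambda>p. f p \<bullet> diff (diff g e) e p)"
    if e: "e \<in> frame" for e
    using torus_integral_by_parts[OF smooth_diff periodic_diff assms(3,4) e, of f e]
      torus_integral_by_parts[OF assms(1,2) smooth_diff periodic_diff e, of g e] assms
    by simp
  show ?thesis
    unfolding vlap_def inner_add_left inner_add_right
    using assms *[of "(2, 0)"] *[of "(0, 2)"]
    by (simp add: torus_integral_add smooth_intros frame_def)
qed

text \<open>Pythagoras for the tangential part of \<open>vlap\<close>. The bienergy density becomes
  a polynomial in the map and its Laplacian, without any connection.\<close>

lemma norm_tension_sq:
  fixes \<phi> :: "real \<times> real \<Rightarrow> 'a::euclidean_space"
  assumes "norm (\<phi> p) = 1"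
  shows "(norm (tension \<phi> p))\<^sup>2 = vlap \<phi> p \<bullet> vlap \<phi> p - (vlap \<phi> p \<bullet> \<phi> p) * (vlap \<phi> p \<bullet> \<phi> p)"
proof -
  have "\<phi> p \<bullet> \<phi> p = 1" using assms by (simp flip: power2_norm_eq_inner)
  moreover have "tension \<phi> p = vlap \<phi> p - (vlap \<phi> p \<bullet> \<phi> p) *\<^sub>R \<phi> p"
    by (simp add: tension_def sum_frame nabla_def vlap_def algebra_simps)
  moreover have "(norm (x - (x \<bullet> y) *\<^sub>R y))\<^sup>2 = x \<bullet> x - (x \<bullet> y) * (x \<bullet> y)"
    if "y \<bullet> y = 1" for x y :: 'a
    using that by (simp add: power2_norm_eq_inner inner_diff_left inner_diff_right inner_commute[of y x])
  ultimately show ?thesis by simp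
qed

lemma Phi_torus_sphere_map: "torus_sphere_map Phi"
  using smooth_frame(5) periodic_frame(5) inner_frame(25)
  by (auto simp: torus_sphere_map_def norm_eq_1)

lemma isometric_immersion_Phi: "isometric_immersion Phi"
  unfolding isometric_immersion_def
proof (intro conjI allI Phi_torus_sphere_map)
  fix p u v
  have *: "diff Phi u p = (fst u / 2) *\<^sub>R tang1 p + (snd u / 2) *\<^sub>R tang2 p" for u
  proof -
    have lin: "linear (\<lambda>e. diff Phi e p)"
      by (rule has_derivative_linear[OF has_derivative_diff[OF smooth_frame(5)]])
    have "u = (fst u / 2) *\<^sub>R (2, 0) + (snd u / 2) *\<^sub>R (0, 2)" by (simp add: prod_eq_iff)
    then have "diff Phi u p = diff Phi ((fst u / 2) *\<^sub>R (2, 0) + (snd u / 2) *\<^sub>R (0, 2)) p" by simp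
    also have "\<dots> = (fst u / 2) *\<^sub>R diff Phi (2, 0) p + (snd u / 2) *\<^sub>R diff Phi (0, 2) p"
      unfolding linear_add[OF lin] linear_scale[OF lin] ..
    finally show ?thesis by (simp add: diff_frame)
  qed
  show "diff Phi u p \<bullet> diff Phi v p = torus_metric u v"
    by (simp add: * inner_add_left inner_add_right inner_frame torus_metric_def inner_prod_def)
qed

lemma vlap_Phi: "vlap Phi = (\<lambda>p. 2 *\<^sub>R norm2 p - 2 *\<^sub>R Phi p)"
  by (simp add: vlap_def[abs_def] diff_frame fun_eq_iff algebra_simps scaleR_2)

text \<open>The sum of \<open>norm2\<close> and \<open>Phi\<close> is a constant vector. This
  identity is what makes the first variation cancel.\<close>

lemma vlap_norm2: "vlap norm2 = (\<lambda>p. - vlap Phi p)"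
  by (simp add: vlap_def[abs_def] diff_frame diff_minus smooth_frame)

text \<open>
  At $t = 0$ the integrand $|\tau(F_t)|^2$ and the function $K$ below have the same $t$-derivative,
  because $\Delta\Phi \cdot \Phi = -2$. As $K$ is linear in $F_t$, the derivatives in the variation
  $\partial_t F$ never have to be exchanged: its integral vanishes for every $t$ by parts.
\<close>

lemma first_variation_Phi:
  assumes "smooth_variation Phi F"
  shows "((\<lambda>t. bienergy (F t)) has_real_derivative 0) (at 0)"
proof -
  define G where "G = (\<lambda>(t, p). F t p)"
  have G: "smooth G" and F0: "F 0 = Phi" and t: "torus_sphere_map (F t)" for t
    using assms by (auto simp: smooth_variation_def G_def)
  have F: "smooth (F t)" "periodic (F t)" "norm (F t p) = 1" for t p
  proof -
    have "F t p \<in> sphere 0 1" using t[of t] unfolding torus_sphere_map_def by blast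
    then show "smooth (F t)" "periodic (F t)" "norm (F t p) = 1"
      using t[of t] by (auto simp: torus_sphere_map_def)
  qed
  have FG: "F t p = G (t, p)" for t p by (simp add: G_def)
  define L where "L z = frechet_derivative (\<lambda>z. frechet_derivative G (at z) (0, (2, 0))) (at z) (0, (2, 0))
      + frechet_derivative (\<lambda>z. frechet_derivative G (at z) (0, (0, 2))) (at z) (0, (0, 2))" for z
  have L: "smooth L" unfolding L_def[abs_def] by (intro smooth_intros smooth_frechet_derivative G)
  have FL: "vlap (F t) p = L (t, p)" for t p
    unfolding vlap_def FG[abs_def] L_def
    by (simp add: diff_slice[OF G] diff_slice[OF smooth_frechet_derivative[OF G]])
  define Q where "Q z = L z \<bullet> L z - (L z \<bullet> G z) * (L z \<bullet> G z)" for z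
  \<comment> \<open>Differentiating \<open>Q\<close> at t = 0 gives 2 (vlap Phi + 2 Phi) . L' + 4
    vlap Phi . G', where the dot is the inner product and L', G' are the t-derivatives of
    \<open>L\<close> and \<open>G\<close>; moreover vlap Phi + 2 Phi = 2 norm2. \<open>K\<close> has
    these coefficients.\<close>
  define K where "K z = 4 * (norm2 (snd z) \<bullet> L z) + 4 * (vlap Phi (snd z) \<bullet> G z)" for z
  have QG: "smooth Q" unfolding Q_def[abs_def] by (intro smooth_intros L G)
  have sA: "smooth (\<lambda>z :: real \<times> (real \<times> real). norm2 (snd z))" "smooth (\<lambda>z :: real \<times> (real \<times> real). vlap Phi (snd z))"
    by (intro smooth_compose_linear[OF bounded_linear_snd] smooth_vlap smooth_frame)+
  have KG: "smooth K" unfolding K_def[abs_def] by (intro smooth_intros L G sA)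
  have bienergy: "bienergy (F t) = 1 / 2 * torus_integral (\<lambda>p. Q (t, p))" for t
    unfolding bienergy_def norm_tension_sq[OF F(3)] FL by (simp add: FG Q_def)
  have "frechet_derivative Q (at (0, p)) (1, 0) = frechet_derivative K (at (0, p)) (1, 0)" for p
  proof -
    let ?L' = "frechet_derivative L (at (0, p))" and ?G' = "frechet_derivative G (at (0, p))"
    have G0: "G (0, p) = Phi p" "L (0, p) = vlap Phi p"
      by (simp_all add: FG[symmetric] FL[symmetric] F0)
    note d = smooth_has_derivative[OF L, of "(0, p)"] smooth_has_derivative[OF G, of "(0, p)"]
    have "(Q has_derivative (\<lambda>v. L (0, p) \<bullet> ?L' v + ?L' v \<bullet> L (0, p)
        - ((L (0, p) \<bullet> G (0, p)) * (L (0, p) \<bullet> ?G' v + ?L' v \<bullet> G (0, p))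
         + (L (0, p) \<bullet> ?G' v + ?L' v \<bullet> G (0, p)) * (L (0, p) \<bullet> G (0, p))))) (at (0, p))"
      unfolding Q_def[abs_def]
      by (intro Deriv.has_derivative_diff has_derivative_mult has_derivative_inner d)
    from frechet_derivative_at[OF this, symmetric]
    have 1: "frechet_derivative Q (at (0, p)) v =
        2 * (vlap Phi p \<bullet> ?L' v) + 4 * (vlap Phi p \<bullet> ?G' v + Phi p \<bullet> ?L' v)" for v
      unfolding G0 by (simp add: vlap_Phi inner_diff_left inner_frame inner_commute algebra_simps)
    have snd: "((\<lambda>z. f (snd z)) has_derivative (\<lambda>v. diff f (snd v) p)) (at (0, p))"
      if "smooth f" for f :: "real \<times> real \<Rightarrow> real^5"
      using has_derivative_compose[OF bounded_linear_imp_has_derivative[OF bounded_linear_snd, of "at (0, p)"] has_derivative_diff[OF that]]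
      by simp
    have zero: "diff f 0 p = 0" if "smooth f" for f :: "real \<times> real \<Rightarrow> real^5"
      using linear_0[OF has_derivative_linear[OF has_derivative_diff[OF that]]] .
    have "(K has_derivative (\<lambda>v. 4 * (norm2 (snd (0 :: real, p)) \<bullet> ?L' v + diff norm2 (snd v) p \<bullet> L (0, p))
        + 4 * (vlap Phi (snd (0 :: real, p)) \<bullet> ?G' v + diff (vlap Phi) (snd v) p \<bullet> G (0, p)))) (at (0, p))"
      unfolding K_def[abs_def]
      by (intro has_derivative_add has_derivative_mult_right has_derivative_inner d snd smooth_vlap smooth_frame)
    from frechet_derivative_at[OF this, symmetric]
    have 2: "frechet_derivative K (at (0, p)) (1, 0) = 4 * (norm2 p \<bullet> ?L' (1, 0)) + 4 * (vlap Phi p \<bullet> ?G' (1, 0))"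
      using zero[of norm2] zero[of "vlap Phi"]
      by (simp add: smooth_vlap smooth_frame flip: zero_prod_def)
    show ?thesis
      unfolding 1 2 by (simp add: vlap_Phi inner_diff_left algebra_simps)
  qed
  moreover have "torus_integral (\<lambda>p. K (t, p)) = 0" for t
  proof -
    have "torus_integral (\<lambda>p. K (t, p)) =
        4 * torus_integral (\<lambda>p. norm2 p \<bullet> vlap (F t) p) + 4 * torus_integral (\<lambda>p. vlap Phi p \<bullet> F t p)"
      unfolding K_def FL[symmetric] FG[symmetric] snd_conv
      by (simp add: torus_integral_add torus_integral_cmult smooth_intros smooth_vlap smooth_frame F)
    also have "torus_integral (\<lambda>p. norm2 p \<bullet> vlap (F t) p) = - torus_integral (\<lambda>p. vlap Phi p \<bullet> F t p)"
      by (subst torus_integral_vlap[symmetric])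
        (simp_all add: smooth_frame periodic_frame F vlap_norm2 torus_integral_minus)
    finally show ?thesis by simp
  qed
  ultimately have "torus_integral (\<lambda>p. frechet_derivative Q (at (0, p)) (1, 0)) = 0"
    using DERIV_unique[OF has_derivative_torus_integral[OF KG, of 0], of 0] by simp
  then show ?thesis
    unfolding bienergy using DERIV_cmult[OF has_derivative_torus_integral[OF QG, of 0], of "1 / 2"] by simp
qed

lemma proper_biharmonic_Phi: "proper_biharmonic Phi"
  unfolding proper_biharmonic_def biharmonic_def
proof (intro conjI allI impI Phi_torus_sphere_map first_variation_Phi)
  have "tension Phi p \<bullet> norm2 p = 2" for p by (simp add: tension_Phi inner_frame_section)
  then show "\<exists>p. tension Phi p \<noteq> 0" by (metis inner_zero_left zero_neq_numeral)
qed

section \<open>The quadratic form of a Fourier mode\<close>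

text \<open>
  $\langle I_2 V, V\rangle$ on the mode with $(a, b) = (2m, 2n)$; the weights 2 in front of the terms in $g^2$
  come from $|\mathrm{norm1}|^2 = 2$.
\<close>

definition jform :: "real \<Rightarrow> real \<Rightarrow> real \<Rightarrow> real \<Rightarrow> real \<Rightarrow> real \<Rightarrow> real" where
  "jform a b x y g h = (let s = a\<^sup>2 + b\<^sup>2; p = a * x + b * y; q = a * x - b * y in
    (s\<^sup>2 + 4 * s) * (x\<^sup>2 + y\<^sup>2) + 2 * (s\<^sup>2 + 12 * s) * g\<^sup>2 + (s\<^sup>2 + 4 * s - 16) * h\<^sup>2
    + 8 * q\<^sup>2 + 4 * p\<^sup>2 - 16 * (a\<^sup>2 - b\<^sup>2) * g * h - 16 * (s + 2) * g * q + 8 * s * h * p)"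

lemma quadratic_form_nonneg:
  fixes u v w :: real
  assumes "0 < u" "v\<^sup>2 \<le> u * w"
  shows "0 \<le> u * x\<^sup>2 + 2 * v * x * y + w * y\<^sup>2"
proof -
  have "0 \<le> (u * x + v * y)\<^sup>2 + (u * w - v\<^sup>2) * y\<^sup>2"
    using assms by simp
  also have "\<dots> = u * (u * x\<^sup>2 + 2 * v * x * y + w * y\<^sup>2)"
    by (simp add: power2_eq_square algebra_simps)
  finally show ?thesis using assms(1) by (simp add: zero_le_mult_iff)
qed

lemma quadratic_form_eq_0:
  fixes u v w :: real
  assumes "0 < u" "v\<^sup>2 < u * w" "u * x\<^sup>2 + 2 * v * x * y + w * y\<^sup>2 \<le> 0"
  shows "x = 0" "y = 0"
proof -
  have "(u * x + v * y)\<^sup>2 + (u * w - v\<^sup>2) * y\<^sup>2 = u * (u * x\<^sup>2 + 2 * v * x * y + w * y\<^sup>2)"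
    by (simp add: power2_eq_square algebra_simps)
  also have "\<dots> \<le> 0" using assms by (simp add: mult_nonneg_nonpos)
  finally have *: "(u * x + v * y)\<^sup>2 + (u * w - v\<^sup>2) * y\<^sup>2 \<le> 0" .
  moreover have "0 \<le> (u * x + v * y)\<^sup>2" by simp
  ultimately have "(u * w - v\<^sup>2) * y\<^sup>2 \<le> 0" by linarith
  then show "y = 0" using assms(2) by (auto simp: mult_le_0_iff not_le)
  with * show "x = 0" using assms(1) by (simp add: sum_power2_le_zero_iff)
qed

text \<open>
  The bound $s |(x, y)|^2 \ge \frac38 p^2 + \frac58 q^2$ and Young's inequality for the $gh$ term split the
  form into blocks in $(q, g)$ and $(p, h)$. Both are positive definite for $s \ge 32$; the
  smaller values $s = 16$ and $s = 20$ need explicit sums of squares.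
\<close>

lemma jform_large_pos:
  assumes s: "32 \<le> a\<^sup>2 + b\<^sup>2" and le: "jform a b x y g h \<le> 0"
  shows "x = 0 \<and> y = 0 \<and> g = 0 \<and> h = 0"
proof -
  define s where "s = a\<^sup>2 + b\<^sup>2"
  define p where "p = a * x + b * y"
  define q where "q = a * x - b * y"
  have s32: "32 \<le> s" using assms by (simp add: s_def)
  \<comment> \<open>Cauchy-Schwarz through Lagrange's identity: the differences of the two sides are
    the squares of a y - b x and a y + b x.\<close>
  have "p\<^sup>2 \<le> s * (x\<^sup>2 + y\<^sup>2)" "q\<^sup>2 \<le> s * (x\<^sup>2 + y\<^sup>2)"
    using zero_le_power2[of "a * y - b * x"] zero_le_power2[of "a * y + b * x"]
    unfolding s_def p_def q_def by (simp_all add: power2_eq_square algebra_simps)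
  then have "3 / 8 * p\<^sup>2 + 5 / 8 * q\<^sup>2 \<le> s * (x\<^sup>2 + y\<^sup>2)" by linarith
  from mult_left_mono[OF this, of "s + 4"]
  have 1: "(s + 4) * (3 / 8 * p\<^sup>2 + 5 / 8 * q\<^sup>2) \<le> (s\<^sup>2 + 4 * s) * (x\<^sup>2 + y\<^sup>2)"
    using s32 by (simp add: power2_eq_square algebra_simps)
  define d where "d = a\<^sup>2 - b\<^sup>2"
  have "\<bar>d\<bar> \<le> s"
    unfolding d_def s_def by (simp add: abs_le_iff)
  have "16 * d * g * h \<le> 16 * s * (\<bar>g\<bar> * \<bar>h\<bar>)"
    using mult_right_mono[of "\<bar>d\<bar>" s "\<bar>g\<bar> * \<bar>h\<bar>"] abs_ge_self[of "d * (g * h)"] \<open>\<bar>d\<bar> \<le> s\<close>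
    by (simp add: abs_mult mult.assoc)
  moreover have "2 * (\<bar>g\<bar> * \<bar>h\<bar>) \<le> 7 / 5 * g\<^sup>2 + 5 / 7 * h\<^sup>2"
    using zero_le_power2[of "7 * \<bar>g\<bar> - 5 * \<bar>h\<bar>"] by (simp add: power2_diff power_mult_distrib)
  from mult_left_mono[OF this, of "8 * s"]
  have "16 * s * (\<bar>g\<bar> * \<bar>h\<bar>) \<le> 8 * s * (7 / 5 * g\<^sup>2 + 5 / 7 * h\<^sup>2)"
    using s32 by simp
  ultimately have 2: "16 * d * g * h \<le> 8 * s * (7 / 5 * g\<^sup>2 + 5 / 7 * h\<^sup>2)"
    by linarith
  define A where "A = ((s + 4) * (5 / 8) + 8) * q\<^sup>2 + 2 * (- (8 * (s + 2))) * q * g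
    + (2 * s\<^sup>2 + 24 * s - 56 / 5 * s) * g\<^sup>2"
  define B where "B = ((s + 4) * (3 / 8) + 4) * p\<^sup>2 + 2 * (4 * s) * p * h
    + (s\<^sup>2 + 4 * s - 16 - 40 / 7 * s) * h\<^sup>2"
  have "A + B \<le> jform a b x y g h"
    using 1 2 unfolding jform_def Let_def s_def[symmetric] p_def[symmetric] q_def[symmetric] d_def[symmetric] A_def B_def
    by (simp add: algebra_simps)
  with le have AB: "A + B \<le> 0" by simp
  have s2: "32 * s \<le> s\<^sup>2" and s3: "32 * s\<^sup>2 \<le> s ^ 3"
    using mult_right_mono[OF s32, of s] mult_right_mono[OF s32, of "s\<^sup>2"] s32
    by (simp_all add: power2_eq_square power3_eq_cube)
  \<comment> \<open>The determinants of the two blocks as cubics in s. At s = 32 they are 972.8 and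
    296, small against their leading terms; the weights 3/8, 5/8 and 7/5, 5/7 keep both positive.
    With \<open>s2\<close> and \<open>s3\<close> the comparison is linear in s^3, s^2 and s.\<close>
  have "((s + 4) * (5 / 8) + 8) * (2 * s\<^sup>2 + 24 * s - 56 / 5 * s) - (- (8 * (s + 2)))\<^sup>2
      = 5 / 4 * s ^ 3 - 35 * s\<^sup>2 - 608 / 5 * s - 256"
    by (simp add: power2_eq_square power3_eq_cube field_simps)
  then have dA: "(- (8 * (s + 2)))\<^sup>2 < ((s + 4) * (5 / 8) + 8) * (2 * s\<^sup>2 + 24 * s - 56 / 5 * s)"
    using s2 s3 s32 by linarith
  have "((s + 4) * (3 / 8) + 4) * (s\<^sup>2 + 4 * s - 16 - 40 / 7 * s) - (4 * s)\<^sup>2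
      = 3 / 8 * s ^ 3 - 78 / 7 * s\<^sup>2 - 108 / 7 * s - 88"
    by (simp add: power2_eq_square power3_eq_cube field_simps)
  then have dB: "(4 * s)\<^sup>2 < ((s + 4) * (3 / 8) + 4) * (s\<^sup>2 + 4 * s - 16 - 40 / 7 * s)"
    using s2 s3 s32 by linarith
  have pos: "0 < (s + 4) * (5 / 8) + 8" "0 < (s + 4) * (3 / 8) + 4"
    using s32 by (auto intro!: add_pos_pos mult_pos_pos)
  have "0 \<le> A"
    unfolding A_def by (rule quadratic_form_nonneg[OF pos(1) less_imp_le[OF dA]])
  moreover have "0 \<le> B"
    unfolding B_def by (rule quadratic_form_nonneg[OF pos(2) less_imp_le[OF dB]])
  ultimately have "A \<le> 0" "B \<le> 0" using AB by auto
  then have "g = 0" "h = 0"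
    using quadratic_form_eq_0(2)[OF pos(1) dA, of q g] quadratic_form_eq_0(2)[OF pos(2) dB, of p h]
    unfolding A_def B_def by blast+
  note z = this
  have "0 < s\<^sup>2 + 4 * s" using s32 by (intro add_pos_pos) auto
  moreover have "(s\<^sup>2 + 4 * s) * (x\<^sup>2 + y\<^sup>2) \<le> 0"
  proof -
    have "(s\<^sup>2 + 4 * s) * (x\<^sup>2 + y\<^sup>2) + 8 * q\<^sup>2 + 4 * p\<^sup>2 \<le> 0"
      using le z unfolding jform_def Let_def s_def[symmetric] p_def[symmetric] q_def[symmetric] by simp
    then show ?thesis using zero_le_power2[of p] zero_le_power2[of q] by linarith
  qed
  ultimately have "x\<^sup>2 + y\<^sup>2 \<le> 0" by (simp add: mult_le_0_iff not_le)
  with z show ?thesis by (simp add: sum_power2_le_zero_iff)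
qed

lemma sum_of_three_nonpos:
  fixes A B C :: real
  assumes "r = i * A + j * B + k * C" "r \<le> 0" "0 < i" "0 < j" "0 < k" "0 \<le> A" "0 \<le> B" "0 \<le> C"
  shows "A = 0" "B = 0" "C = 0"
proof -
  have "0 \<le> i * A" "0 \<le> j * B" "0 \<le> k * C" using assms by simp_all
  then have "i * A = 0" "j * B = 0" "k * C = 0" using assms by linarith+
  then show "A = 0" "B = 0" "C = 0" using assms by auto
qed

text \<open>The symmetry of the torus that exchanges its two circles; it reverses the normal
  \<open>norm1\<close>, hence the sign of g.\<close>

lemma jform_swap: "jform b a y x (- g) h = jform a b x y g h"
  by (simp add: jform_def Let_def power2_eq_square algebra_simps)

text \<open>Here y decouples. Completing the square in a x leaves a form in (g, h) with determinant
  31/2 * 11 - 100 > 0.\<close>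

lemma jform_16_pos:
  assumes ab: "a\<^sup>2 = 16" "b = 0" and le: "jform a b x y g h \<le> 0"
  shows "x = 0 \<and> y = 0 \<and> g = 0 \<and> h = 0"
proof -
  define X where "X = a * x"
  have X: "x\<^sup>2 = X\<^sup>2 / 16" using ab by (simp add: X_def power_mult_distrib)
  have eq: "jform a b x y g h = 320 * y\<^sup>2 + 32 * (X - 9 / 2 * g + 2 * h)\<^sup>2
      + 16 * (31 / 2 * g\<^sup>2 + 2 * 10 * g * h + 11 * h\<^sup>2)"
    unfolding jform_def Let_def ab X X_def[symmetric]
    by (simp add: ab power2_eq_square algebra_simps)
  have nn: "0 \<le> 31 / 2 * g\<^sup>2 + 2 * 10 * g * h + 11 * h\<^sup>2"
    by (rule quadratic_form_nonneg) (auto simp: power2_eq_square)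
  note z = sum_of_three_nonpos[OF eq le _ _ _ _ _ nn]
  have z: "31 / 2 * g\<^sup>2 + 2 * 10 * g * h + 11 * h\<^sup>2 = 0" "y\<^sup>2 = 0"
      "(X - 9 / 2 * g + 2 * h)\<^sup>2 = 0"
    by (rule z; simp)+
  have "g = 0" "h = 0"
    by (rule quadratic_form_eq_0[OF _ _ eq_refl[OF z(1)]]; simp add: power2_eq_square)+
  with z ab show ?thesis by (auto simp: X_def)
qed

text \<open>Gaussian elimination of a x and then b y: the pivots are 42 and 2764/21 = 4 * 691/21, so
  multiplying by 21 * 691 clears all denominators.\<close>

lemma jform_20_pos:
  assumes ab: "a\<^sup>2 = 16" "b\<^sup>2 = 4" and le: "jform a b x y g h \<le> 0"
  shows "x = 0 \<and> y = 0 \<and> g = 0 \<and> h = 0"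
proof -
  define X where "X = a * x"
  define Y where "Y = b * y"
  have XY: "x\<^sup>2 = X\<^sup>2 / 16" "y\<^sup>2 = Y\<^sup>2 / 4"
    using ab by (simp_all add: X_def Y_def power_mult_distrib)
  have eq: "21 * 691 * jform a b x y g h = 2 * 691 * (21 * X - 2 * Y - 88 * g + 40 * h)\<^sup>2
      + 4 * (691 * Y + 836 * g + 460 * h)\<^sup>2
      + 4 * (1269072 * g\<^sup>2 + 2 * 483336 * g * h + 918876 * h\<^sup>2)"
    unfolding jform_def Let_def ab XY X_def[symmetric] Y_def[symmetric]
    by (simp add: ab power2_eq_square algebra_simps)
  have nn: "0 \<le> 1269072 * g\<^sup>2 + 2 * 483336 * g * h + 918876 * h\<^sup>2"
    by (rule quadratic_form_nonneg) (auto simp: power2_eq_square)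
  have "21 * 691 * jform a b x y g h \<le> 0" using le by simp
  note z = sum_of_three_nonpos[OF eq this _ _ _ _ _ nn]
  have z: "1269072 * g\<^sup>2 + 2 * 483336 * g * h + 918876 * h\<^sup>2 = 0"
      "(21 * X - 2 * Y - 88 * g + 40 * h)\<^sup>2 = 0" "(691 * Y + 836 * g + 460 * h)\<^sup>2 = 0"
    by (rule z; simp)+
  have "g = 0" "h = 0"
    by (rule quadratic_form_eq_0[OF _ _ eq_refl[OF z(1)]]; simp add: power2_eq_square)+
  with z ab show ?thesis by (auto simp: X_def Y_def)
qed

text \<open>With a = 2m and b = 2n the uniform bound 32 reads m^2 + n^2 >= 8. Below it, an entry of
  modulus above 1 forces the squares 4 and 0 or 4 and 1, and \<open>jform_swap\<close> brings the
  larger one to the front.\<close>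

lemma jform_high_modes_pos:
  fixes m n :: int
  assumes mn: "1 < \<bar>m\<bar> \<or> 1 < \<bar>n\<bar>" and le: "jform (2 * m) (2 * n) x y g h \<le> 0"
  shows "x = 0 \<and> y = 0 \<and> g = 0 \<and> h = 0"
proof (cases "8 \<le> m\<^sup>2 + n\<^sup>2")
  case True
  then have "8 \<le> real_of_int (m\<^sup>2 + n\<^sup>2)" by linarith
  then show ?thesis using le by (intro jform_large_pos[of "2 * m" "2 * n"]) (auto simp: power_mult_distrib)
next
  case False
  have le': "jform (2 * n) (2 * m) y x (- g) h \<le> 0" using le by (simp only: jform_swap)
  have "\<bar>k\<bar> \<le> 2" if "k\<^sup>2 < 8" for k :: int
    using that abs_le_square_iff[of 3 k] by (auto simp: not_le)
  moreover have "m\<^sup>2 < 8" "n\<^sup>2 < 8"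
    using False zero_le_power2[of m] zero_le_power2[of n] by linarith+
  ultimately have "\<bar>m\<bar> \<le> 2" "\<bar>n\<bar> \<le> 2" by auto
  moreover have "k = 0 \<or> k\<^sup>2 = 1 \<or> k\<^sup>2 = 4" if "\<bar>k\<bar> \<le> 2" for k :: int
  proof -
    have "k \<in> {-2, -1, 0, 1, 2}" using that by auto
    then show ?thesis by auto
  qed
  ultimately have "m = 0 \<or> m\<^sup>2 = 1 \<or> m\<^sup>2 = 4" "n = 0 \<or> n\<^sup>2 = 1 \<or> n\<^sup>2 = 4" by auto
  moreover have "k\<^sup>2 \<noteq> 1" "k \<noteq> 0" if "1 < \<bar>k\<bar>" for k :: int
    using that by (auto simp: power2_eq_1_iff)
  ultimately consider "m\<^sup>2 = 4" "n = 0" | "m = 0" "n\<^sup>2 = 4" | "m\<^sup>2 = 4" "n\<^sup>2 = 1" | "m\<^sup>2 = 1" "n\<^sup>2 = 4"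
    using mn False by (metis dual_order.refl numeral_Bit0)
  moreover have sq: "k\<^sup>2 = j \<Longrightarrow> (2 * real_of_int k)\<^sup>2 = 4 * j" for k j
    by (auto simp: power_mult_distrib)
  ultimately show ?thesis
  proof cases
    case 1
    then show ?thesis using sq[of m 4] le by (intro jform_16_pos[of "2 * m" "2 * n"]) auto
  next
    case 2
    then show ?thesis using sq[of n 4] jform_16_pos[OF _ _ le'] by auto
  next
    case 3
    then show ?thesis using sq[of m 4] sq[of n 1] le by (intro jform_20_pos[of "2 * m" "2 * n"]) auto
  next
    case 4
    then show ?thesis using sq[of n 4] sq[of m 1] jform_20_pos[OF _ _ le'] by auto
  qed
qed

text \<open>Three squares in four unknowns: the form is visibly nonnegative and its null space is a
  line. For a = 2 the line is spanned by (2, 0, 1, -2), a coefficient vector of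
  \<open>kernel_basis\<close>.\<close>

lemma jform_axis:
  assumes "a\<^sup>2 = 4"
  shows "jform a 0 x y g h = 32 * y\<^sup>2 + 16 * (h - 2 * g + a * x)\<^sup>2 + 16 * (a * x / 2 - 2 * g)\<^sup>2"
proof -
  define X where "X = a * x"
  have X: "x\<^sup>2 = X\<^sup>2 / 4" using assms by (simp add: X_def power_mult_distrib)
  show ?thesis
    unfolding jform_def Let_def assms X X_def[symmetric]
    by (simp add: power2_eq_square field_simps)
qed

lemma jform_axis':
  assumes "b\<^sup>2 = 4"
  shows "jform 0 b x y g h = 32 * x\<^sup>2 + 16 * (h + 2 * g + b * y)\<^sup>2 + 16 * (b * y / 2 + 2 * g)\<^sup>2"
  using jform_swap[of b 0 y x g h] jform_axis[OF assms, of y x "- g" h]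
  by (simp add: algebra_simps)

text \<open>Again three independent squares. The null line is spanned by (1, -1, 1, 0) for a = b = 2
  and by (1, 1, 1, 0) for a = 2, b = -2.\<close>

lemma jform_diagonal:
  assumes "a\<^sup>2 = 4" "b\<^sup>2 = 4"
  shows "jform a b x y g h = 80 * ((a * x - b * y) / 2 - 2 * g)\<^sup>2 + 64 * ((a * x + b * y) / 2 + h)\<^sup>2 + 16 * h\<^sup>2"
proof -
  define X where "X = a * x"
  define Y where "Y = b * y"
  have XY: "x\<^sup>2 = X\<^sup>2 / 4" "y\<^sup>2 = Y\<^sup>2 / 4"
    using assms by (simp_all add: X_def Y_def power_mult_distrib)
  show ?thesis
    unfolding jform_def Let_def assms XY X_def[symmetric] Y_def[symmetric]
    by (simp add: power2_eq_square field_simps)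
qed

lemma jform_nonneg:
  fixes m n :: int
  assumes "(m, n) \<noteq> (0, 0)"
  shows "0 \<le> jform (2 * m) (2 * n) x y g h"
proof (cases "1 < \<bar>m\<bar> \<or> 1 < \<bar>n\<bar>")
  case True
  \<comment> \<open>A nonpositive value forces all four arguments to vanish, and then the value is
    0.\<close>
  then show ?thesis using jform_high_modes_pos[of m n x y g h]
    by (cases "jform (2 * m) (2 * n) x y g h \<le> 0") (auto simp: jform_def)
next
  case False
  then have "m \<in> {-1, 0, 1}" "n \<in> {-1, 0, 1}" by auto
  then show ?thesis
    using assms by (elim insertE emptyE) (simp_all add: jform_axis jform_axis' jform_diagonal)
qed

section \<open>Fourier modes of the Jacobi operator\<close>

text \<open>
  The matrices of the rough Laplacian and of $I_2$ on the coefficients of a mode with $(a, b) = (2m, 2n)$.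
  Tangential coefficients are paired with cosines and normal ones with sines, which makes the matrices real.
\<close>

definition lsym1 :: "real \<Rightarrow> real \<Rightarrow> real \<Rightarrow> real \<Rightarrow> real \<Rightarrow> real \<Rightarrow> real" where
  "lsym1 a b x y g h = (a\<^sup>2 + b\<^sup>2 + 3) * x - 4 * a * g + 2 * a * h"

definition lsym2 :: "real \<Rightarrow> real \<Rightarrow> real \<Rightarrow> real \<Rightarrow> real \<Rightarrow> real \<Rightarrow> real" where
  "lsym2 a b x y g h = (a\<^sup>2 + b\<^sup>2 + 3) * y + 4 * b * g + 2 * b * h"

definition lsym3 :: "real \<Rightarrow> real \<Rightarrow> real \<Rightarrow> real \<Rightarrow> real \<Rightarrow> real \<Rightarrow> real" where
  "lsym3 a b x y g h = (a\<^sup>2 + b\<^sup>2 + 4) * g - 2 * a * x + 2 * b * y"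

definition lsym4 :: "real \<Rightarrow> real \<Rightarrow> real \<Rightarrow> real \<Rightarrow> real \<Rightarrow> real \<Rightarrow> real" where
  "lsym4 a b x y g h = (a\<^sup>2 + b\<^sup>2 + 2) * h + 2 * a * x + 2 * b * y"

definition jsym1 :: "real \<Rightarrow> real \<Rightarrow> real \<Rightarrow> real \<Rightarrow> real \<Rightarrow> real \<Rightarrow> real" where
  "jsym1 a b x y g h = (a\<^sup>2 + b\<^sup>2 + 2) * lsym1 a b x y g h - 4 * a * lsym3 a b x y g h + 2 * a * lsym4 a b x y g h
    - (a\<^sup>2 + b\<^sup>2 + 6) * x + 8 * a * g - 8 * a * h"

definition jsym2 :: "real \<Rightarrow> real \<Rightarrow> real \<Rightarrow> real \<Rightarrow> real \<Rightarrow> real \<Rightarrow> real" where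
  "jsym2 a b x y g h = (a\<^sup>2 + b\<^sup>2 + 2) * lsym2 a b x y g h + 4 * b * lsym3 a b x y g h + 2 * b * lsym4 a b x y g h
    - (a\<^sup>2 + b\<^sup>2 + 6) * y - 8 * b * g - 8 * b * h"

definition jsym3 :: "real \<Rightarrow> real \<Rightarrow> real \<Rightarrow> real \<Rightarrow> real \<Rightarrow> real \<Rightarrow> real" where
  "jsym3 a b x y g h = (a\<^sup>2 + b\<^sup>2 + 2) * lsym3 a b x y g h - 2 * a * lsym1 a b x y g h + 2 * b * lsym2 a b x y g h
    - 2 * (a\<^sup>2 + b\<^sup>2 + 4) * g + 2 * a * x - 2 * b * y"

definition jsym4 :: "real \<Rightarrow> real \<Rightarrow> real \<Rightarrow> real \<Rightarrow> real \<Rightarrow> real \<Rightarrow> real" where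
  "jsym4 a b x y g h = (a\<^sup>2 + b\<^sup>2) * lsym4 a b x y g h + 2 * a * lsym1 a b x y g h + 2 * b * lsym2 a b x y g h
    - 2 * (a\<^sup>2 + b\<^sup>2 + 8) * h - 6 * a * x - 6 * b * y"

lemmas lsym_defs = lsym1_def lsym2_def lsym3_def lsym4_def

lemmas jsym_defs = jsym1_def jsym2_def jsym3_def jsym4_def

lemma jform_eq: "x * jsym1 a b x y g h + y * jsym2 a b x y g h + 2 * (g * jsym3 a b x y g h)
    + h * jsym4 a b x y g h = jform a b x y g h"
  unfolding jsym_defs lsym_defs jform_def Let_def by (simp add: power2_eq_square algebra_simps)

lemma fc_lap:
  assumes "smooth f" "periodic f"
  shows "fc (lap f) m n c = ((2 * m)\<^sup>2 + (2 * n)\<^sup>2) * fc f m n c" "fs (lap f) m n c = ((2 * m)\<^sup>2 + (2 * n)\<^sup>2) * fs f m n c"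
  unfolding lap_def[abs_def] using assms
  by (simp_all add: fc_diff fs_diff fc_minus fs_minus fc_frame_derivative smooth_intros periodic_intros
      power2_eq_square algebra_simps)

text \<open>Every first derivative in the operator couples a tangential with a normal component and
  also exchanges \<open>fc\<close> with \<open>fs\<close>. Taking \<open>fc\<close> of the former
  and \<open>fs\<close> of the latter, at one common phase, therefore closes the system over the
  reals.\<close>

lemma fourier_jacobi2:
  fixes m n :: int and c \<mu> :: real
  assumes s: "smooth x" "smooth y" "smooth g" "smooth h"
    and p: "periodic x" "periodic y" "periodic g" "periodic h"
    and V: "V = frame_section x y g h" and eigen: "\<And>p. jacobi2 Phi V p = \<mu> *\<^sub>R V p"
  defines "X \<equiv> fc x m n c" and "Y \<equiv> fc y m n c" and "G \<equiv> fs g m n c" and "H \<equiv> fs h m n c"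
  shows "jsym1 (2 * m) (2 * n) X Y G H = \<mu> * X" "jsym2 (2 * m) (2 * n) X Y G H = \<mu> * Y"
    "jsym3 (2 * m) (2 * n) X Y G H = \<mu> * G" "jsym4 (2 * m) (2 * n) X Y G H = \<mu> * H"
proof -
  define lx where "lx = (\<lambda>p. lap x p + 3 * x p - 4 * d1 g p + 2 * d1 h p)"
  define ly where "ly = (\<lambda>p. lap y p + 3 * y p + 4 * d2 g p + 2 * d2 h p)"
  define lg where "lg = (\<lambda>p. lap g p + 4 * g p + 2 * d1 x p - 2 * d2 y p)"
  define lh where "lh = (\<lambda>p. lap h p + 2 * h p - 2 * d1 x p - 2 * d2 y p)"
  have ls: "smooth lx" "smooth ly" "smooth lg" "smooth lh"
    unfolding lx_def ly_def lg_def lh_def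
    by (intro smooth_intros smooth_lap s)+
  have lp: "periodic lx" "periodic ly" "periodic lg" "periodic lh"
    unfolding lx_def ly_def lg_def lh_def
    by (intro periodic_intros periodic_lap s p)+
  note F = fc_add fc_diff fc_cmult fc_minus fs_minus fs_add fs_diff fs_cmult fc_frame_derivative fc_lap smooth_intros smooth_lap
  have l: "fc lx m n c = lsym1 (2 * m) (2 * n) X Y G H" "fc ly m n c = lsym2 (2 * m) (2 * n) X Y G H"
    "fs lg m n c = lsym3 (2 * m) (2 * n) X Y G H" "fs lh m n c = lsym4 (2 * m) (2 * n) X Y G H"
    unfolding lx_def ly_def lg_def lh_def X_def Y_def G_def H_def
    using s p by (simp_all add: F lsym_defs) (simp_all add: algebra_simps)
  have "jacobi2 Phi V p = frame_section (\<lambda>p. \<mu> * x p) (\<lambda>p. \<mu> * y p) (\<lambda>p. \<mu> * g p) (\<lambda>p. \<mu> * h p) p" for p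
    unfolding eigen unfolding V frame_section_scaleR ..
  note eq = this[unfolded V jacobi2_frame_section[OF s lx_def ly_def lg_def lh_def]
      frame_section_eq_iff]
  have j:
    "(\<lambda>p. \<mu> * x p) = (\<lambda>p. lap lx p + 3 * lx p - 4 * d1 lg p + 2 * d1 lh p
        - lap x p - 3 * x p + 8 * d1 g p - 4 * d1 h p - lx p - 3 * x p - 4 * d1 h p)"
    "(\<lambda>p. \<mu> * y p) = (\<lambda>p. lap ly p + 3 * ly p + 4 * d2 lg p + 2 * d2 lh p
        - lap y p - 3 * y p - 8 * d2 g p - 4 * d2 h p - ly p - 3 * y p - 4 * d2 h p)"
    "(\<lambda>p. \<mu> * g p) = (\<lambda>p. lap lg p + 4 * lg p + 2 * d1 lx p - 2 * d2 ly p
        - 2 * lap g p - 8 * g p - 2 * d1 x p + 2 * d2 y p - 2 * lg p)"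
    "(\<lambda>p. \<mu> * h p) = (\<lambda>p. lap lh p + 2 * lh p - 2 * d1 lx p - 2 * d2 ly p
        - 2 * lap h p - 4 * h p + 2 * d1 x p + 2 * d2 y p - 2 * lh p - 12 * h p + 4 * d1 x p + 4 * d2 y p)"
    by (rule ext, rule eq[THEN conjunct1, symmetric] eq[THEN conjunct2, THEN conjunct1, symmetric]
      eq[THEN conjunct2, THEN conjunct2, THEN conjunct1, symmetric]
      eq[THEN conjunct2, THEN conjunct2, THEN conjunct2, symmetric])+
  have "\<mu> * X = fc (\<lambda>p. \<mu> * x p) m n c" "\<mu> * Y = fc (\<lambda>p. \<mu> * y p) m n c"
    "\<mu> * G = fs (\<lambda>p. \<mu> * g p) m n c" "\<mu> * H = fs (\<lambda>p. \<mu> * h p) m n c"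
    by (simp_all add: X_def Y_def G_def H_def fc_cmult fs_cmult)
  then show "jsym1 (2 * m) (2 * n) X Y G H = \<mu> * X" "jsym2 (2 * m) (2 * n) X Y G H = \<mu> * Y"
    "jsym3 (2 * m) (2 * n) X Y G H = \<mu> * G" "jsym4 (2 * m) (2 * n) X Y G H = \<mu> * H"
    unfolding j using s p ls lp
    by (simp_all add: F jsym_defs l flip: X_def Y_def G_def H_def)
      (simp_all add: algebra_simps)
qed

text \<open>The phases 0 and pi/2 give the two real fields of a mode. At mode (0, 0) they separate
  instead: phase 0 leaves only the tangential constants, phase pi/2 only the normal ones.\<close>

definition mode_field :: "int \<Rightarrow> int \<Rightarrow> real \<Rightarrow> real \<Rightarrow> real \<Rightarrow> real \<Rightarrow> real \<Rightarrow> real \<times> real \<Rightarrow> real^5" where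
  "mode_field m n c x y g h = frame_section (\<lambda>p. x * cos (phase m n c p)) (\<lambda>p. y * cos (phase m n c p))
     (\<lambda>p. g * sin (phase m n c p)) (\<lambda>p. h * sin (phase m n c p))"

lemma mode_field_in_sections: "mode_field m n c x y g h \<in> sections Phi"
  unfolding mode_field_def
  by (intro frame_section_in_sections smooth_intros periodic_intros trig_intros)

text \<open>The counterpart of \<open>fourier_jacobi2\<close> for existence: null vectors and
  eigenvectors of a mode matrix yield actual fields.\<close>

lemma jacobi2_mode_field:
  fixes m n :: int
  defines "a \<equiv> 2 * real_of_int m" and "b \<equiv> 2 * real_of_int n"
  shows "jacobi2 Phi (mode_field m n c x y g h) = mode_field m n c
    (jsym1 a b x y g h) (jsym2 a b x y g h) (jsym3 a b x y g h) (jsym4 a b x y g h)"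
proof -
  let ?C = "\<lambda>p. cos (phase m n c p)" and ?S = "\<lambda>p. sin (phase m n c p)"
  note s = smooth_intros trig_intros
  have d: "d1 (\<lambda>p. r * ?C p) = (\<lambda>p. (- a * r) * ?S p)" "d2 (\<lambda>p. r * ?C p) = (\<lambda>p. (- b * r) * ?S p)"
    "d1 (\<lambda>p. r * ?S p) = (\<lambda>p. (a * r) * ?C p)" "d2 (\<lambda>p. r * ?S p) = (\<lambda>p. (b * r) * ?C p)" for r
    by (simp_all add: diff_cmult s diff_cos_phase diff_sin_phase a_def b_def fun_eq_iff)
  have l: "lap (\<lambda>p. r * ?C p) = (\<lambda>p. (a\<^sup>2 + b\<^sup>2) * r * ?C p)" "lap (\<lambda>p. r * ?S p) = (\<lambda>p. (a\<^sup>2 + b\<^sup>2) * r * ?S p)" for r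
    unfolding lap_def[abs_def] d by (simp_all add: power2_eq_square algebra_simps)
  have L: "(\<lambda>p. lap (\<lambda>p. x * ?C p) p + 3 * (x * ?C p) - 4 * d1 (\<lambda>p. g * ?S p) p + 2 * d1 (\<lambda>p. h * ?S p) p)
      = (\<lambda>p. lsym1 a b x y g h * ?C p)"
    "(\<lambda>p. lap (\<lambda>p. y * ?C p) p + 3 * (y * ?C p) + 4 * d2 (\<lambda>p. g * ?S p) p + 2 * d2 (\<lambda>p. h * ?S p) p)
      = (\<lambda>p. lsym2 a b x y g h * ?C p)"
    "(\<lambda>p. lap (\<lambda>p. g * ?S p) p + 4 * (g * ?S p) + 2 * d1 (\<lambda>p. x * ?C p) p - 2 * d2 (\<lambda>p. y * ?C p) p)
      = (\<lambda>p. lsym3 a b x y g h * ?S p)"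
    "(\<lambda>p. lap (\<lambda>p. h * ?S p) p + 2 * (h * ?S p) - 2 * d1 (\<lambda>p. x * ?C p) p - 2 * d2 (\<lambda>p. y * ?C p) p)
      = (\<lambda>p. lsym4 a b x y g h * ?S p)"
    unfolding d l lsym_defs by (simp_all add: algebra_simps)
  have sm: "smooth (\<lambda>p. r * ?C p)" "smooth (\<lambda>p. r * ?S p)" for r
    by (intro s)+
  show ?thesis
    unfolding mode_field_def jacobi2_frame_section[OF sm(1) sm(1) sm(2) sm(2) L[symmetric]]
    unfolding d l fun_eq_iff frame_section_eq_iff jsym_defs
    by (simp add: algebra_simps)
qed

section \<open>Index and nullity\<close>

lemma sum_fun_apply: "(\<Sum>a\<in>A. F a) p = (\<Sum>a\<in>A. F a p)"
  by (induction A rule: infinite_finite_induct) auto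

lemma edim_eq_of_basis:
  fixes b :: "nat \<Rightarrow> 'b \<Rightarrow> 'a::real_vector"
  assumes mem: "\<And>i. i < n \<Longrightarrow> b i \<in> E"
    and span: "\<And>V. V \<in> E \<Longrightarrow> \<exists>u. \<forall>p. V p = (\<Sum>i<n. u i *\<^sub>R b i p)"
    and indep: "\<And>u i. (\<And>p. (\<Sum>i<n. u i *\<^sub>R b i p) = 0) \<Longrightarrow> i < n \<Longrightarrow> u i = 0"
  shows "edim E = enat n"
proof -
  define B where "B = b ` {..<n}"
  have inj: "inj_on b {..<n}"
  proof (rule inj_onI, rule ccontr)
    fix i j assume ij: "i \<in> {..<n}" "j \<in> {..<n}" "b i = b j" "i \<noteq> j"
    \<comment> \<open>If two indices gave the same field, the difference of their unit coefficient
      families would contradict independence.\<close>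
    let ?u = "\<lambda>k. (if k = i then 1 else 0) - (if k = j then 1 else 0 :: real)"
    have "(\<Sum>k<n. ?u k *\<^sub>R b k p) = b i p - b j p" for p
      using ij(1,2) by (simp add: scaleR_left_diff_distrib sum_subtractf if_distrib[of "\<lambda>r. r *\<^sub>R _"] cong: if_cong)
    then have "(\<Sum>k<n. ?u k *\<^sub>R b k p) = 0" for p using ij(3) by simp
    from indep[of ?u i, OF this] ij show False by auto
  qed
  have card: "card B = n" by (simp add: B_def card_image[OF inj])
  have "fun_space.independent B"
  proof (rule fun_space.independent_if_scalars_zero)
    show "finite B" by (simp add: B_def)
    fix f v assume sum: "(\<Sum>x\<in>B. (\<lambda>p. f x *\<^sub>R x p)) = 0" and "v \<in> B"
    then obtain i where i: "i < n" "v = b i" by (auto simp: B_def)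
    have "(\<Sum>k<n. f (b k) *\<^sub>R b k p) = 0" for p
      using fun_cong[OF sum, of p] unfolding sum_fun_apply B_def
      by (simp add: sum.reindex[OF inj])
    from indep[of "\<lambda>k. f (b k)", OF this i(1)] show "f v = 0" by (simp add: i)
  qed
  moreover have "E \<subseteq> fun_space.span B"
  proof
    fix V assume "V \<in> E"
    then obtain u where u: "V p = (\<Sum>i<n. u i *\<^sub>R b i p)" for p using span by blast
    have "V = (\<Sum>i<n. (\<lambda>p. u i *\<^sub>R b i p))" by (rule ext) (simp add: sum_fun_apply u)
    also have "\<dots> \<in> fun_space.span B"
      by (intro fun_space.span_sum fun_space.span_scale fun_space.span_base) (simp add: B_def)
    finally show "V \<in> fun_space.span B" .
  qed
  moreover have "B \<subseteq> E" using mem by (auto simp: B_def)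
  ultimately have "fun_space.dim E = n"
    using card by (intro fun_space.dim_unique)
  \<comment> \<open>Rules out the infinite branch of \<open>edim\<close>.\<close>
  moreover have "\<exists>B. finite B \<and> E \<subseteq> fun_space.span B"
    using \<open>E \<subseteq> fun_space.span B\<close> by (intro exI[of _ B]) (simp add: B_def)
  ultimately show ?thesis by (simp add: edim_def)
qed

lemma phase_half_pi:
  "cos (phase m n (pi / 2) p) = - sin (phase m n 0 p)" "sin (phase m n (pi / 2) p) = cos (phase m n 0 p)"
  by (simp_all add: phase_def cos_add sin_add)

lemma fc_fs_half_pi: "fc f m n (pi / 2) = - fs f m n 0" "fs f m n (pi / 2) = fc f m n 0"
  by (simp_all add: fc_def fs_def phase_half_pi torus_integral_minus)

text \<open>The mode equations control \<open>fs\<close> of the normal components, whereas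
  uniqueness and expansion ask for \<open>fc\<close>; over all phases these are the same
  data.\<close>

lemma fc_eq_fs: "fc f m n c = fs f m n (c + pi / 2)"
proof -
  have "sin (phase m n (c + pi / 2) p) = cos (phase m n c p)" for p
    by (simp add: phase_def sin_add cos_add algebra_simps)
  then show ?thesis by (simp add: fc_def fs_def)
qed

lemma jform_eigen:
  fixes m n :: int
  assumes "smooth x" "smooth y" "smooth g" "smooth h"
    and "periodic x" "periodic y" "periodic g" "periodic h"
    and "\<And>p. jacobi2 Phi (frame_section x y g h) p = \<mu> *\<^sub>R frame_section x y g h p"
  shows "jform (2 * m) (2 * n) (fc x m n c) (fc y m n c) (fs g m n c) (fs h m n c)
    = \<mu> * ((fc x m n c)\<^sup>2 + (fc y m n c)\<^sup>2 + 2 * (fs g m n c)\<^sup>2 + (fs h m n c)\<^sup>2)"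
  unfolding jform_eq[symmetric]
  unfolding fourier_jacobi2[OF assms(1-8) refl assms(9), of m n c]
  by (simp add: power2_eq_square algebra_simps)

text \<open>At mode (0, 0) all derivatives drop out and the matrix is diagonal with entries 0, 0, 0,
  -16.\<close>

lemma fourier_zero_mode:
  assumes "smooth x" "smooth y" "smooth g" "smooth h"
    and "periodic x" "periodic y" "periodic g" "periodic h"
    and "\<And>p. jacobi2 Phi (frame_section x y g h) p = \<mu> *\<^sub>R frame_section x y g h p"
  shows "\<mu> * fc x 0 0 c = 0" "\<mu> * fc y 0 0 c = 0" "\<mu> * fs g 0 0 c = 0" "- 16 * fs h 0 0 c = \<mu> * fs h 0 0 c"
  using fourier_jacobi2[OF assms(1-8) refl assms(9), of 0 0 c]
  by (simp_all add: jsym_defs lsym_defs)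

text \<open>On a nonzero mode the form is nonnegative and equals \<mu> < 0 times a weighted sum of
  squares, so the mode vanishes; in the zero mode only h survives. The disjunction serves both to
  locate the eigenvalue and to describe its eigenspace.\<close>

lemma negative_eigenfield:
  assumes V: "V \<in> eigenspace Phi \<mu>" and "\<mu> < 0"
  obtains k where "\<And>p. V p = k *\<^sub>R norm2 p" "k = 0 \<or> \<mu> = - 16"
proof -
  obtain x y g h where s: "smooth x" "smooth y" "smooth g" "smooth h"
    and p: "periodic x" "periodic y" "periodic g" "periodic h" and eq: "V = frame_section x y g h"
    using V sections_frame_section unfolding eigenspace_def by blast
  have eigen: "jacobi2 Phi (frame_section x y g h) p = \<mu> *\<^sub>R frame_section x y g h p" for p
    using V unfolding eq eigenspace_def by blast
  have *: "fc x m n c = 0 \<and> fc y m n c = 0 \<and> fs g m n c = 0 \<and> fs h m n c = 0" if "(m, n) \<noteq> (0, 0)" for m n :: int and c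
  proof -
    let ?N = "(fc x m n c)\<^sup>2 + (fc y m n c)\<^sup>2 + (2 * (fs g m n c)\<^sup>2 + (fs h m n c)\<^sup>2)"
    have "0 \<le> \<mu> * ?N"
      using jform_nonneg[OF that, of "fc x m n c" "fc y m n c" "fs g m n c" "fs h m n c"]
      unfolding jform_eigen[OF s p eigen] by (simp add: add.assoc)
    then have "?N \<le> 0" using \<open>\<mu> < 0\<close> by (simp add: zero_le_mult_iff)
    moreover have "0 \<le> (fc x m n c)\<^sup>2" "0 \<le> (fc y m n c)\<^sup>2" "0 \<le> (fs g m n c)\<^sup>2" "0 \<le> (fs h m n c)\<^sup>2" by simp_all
    ultimately have "(fc x m n c)\<^sup>2 = 0" "(fc y m n c)\<^sup>2 = 0" "(fs g m n c)\<^sup>2 = 0" "(fs h m n c)\<^sup>2 = 0"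
      by linarith+
    then show ?thesis by simp
  qed
  note zero = fourier_zero_mode[OF s p eigen]
  have all0: "fc x m n c = 0" "fc y m n c = 0" "fs g m n c = 0" for m n c
    using *[of m n c] zero(1-3)[of c] \<open>\<mu> < 0\<close> by (cases "(m, n) = (0, 0)"; simp)+
  have g0: "fc g m n c = 0" for m n c
    unfolding fc_eq_fs by (rule all0)
  have x: "x = (\<lambda>p. 0)"
    by (rule fourier_uniqueness[OF s(1) p(1)]) (simp add: all0 flip: fc_def)
  have y: "y = (\<lambda>p. 0)"
    by (rule fourier_uniqueness[OF s(2) p(2)]) (simp add: all0 flip: fc_def)
  have g: "g = (\<lambda>p. 0)"
    by (rule fourier_uniqueness[OF s(3) p(3)]) (simp add: g0 flip: fc_def)
  define k where "k = 1 / pi\<^sup>2 * fc h 0 0 0"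
  have h0: "fc h m n c = 0" if "(m, n) \<noteq> (0, 0)" for m n c
    unfolding fc_eq_fs using *[OF that] by simp
  have h1: "fs h m n 0 = 0" if "(m, n) \<noteq> (0, 0)" for m n
    using *[OF that] by simp
  have high: "fc h m n c = 0" if "1 < \<bar>m\<bar> \<or> 1 < \<bar>n\<bar>" for m n c
    using that by (intro h0) auto
  have h: "h p = k" for p
    by (subst fourier_expansion_low_modes[OF s(4) p(4) high]) (auto simp: h0 h1 k_def)
  show ?thesis
  proof
    show "V p = k *\<^sub>R norm2 p" for p by (simp add: eq frame_section_def x y g h)
    \<comment> \<open>At mode (0, 0) the coefficient \<open>fs\<close> with phase 0 is identically
      zero; the phase pi/2 turns it into the integral of h.\<close>
    have "(\<mu> + 16) * fc h 0 0 0 = 0"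
      using zero(4)[of "pi / 2"] by (simp add: fc_fs_half_pi algebra_simps)
    then show "k = 0 \<or> \<mu> = - 16" by (auto simp: k_def)
  qed
qed

lemma norm2_eigenspace: "norm2 \<in> eigenspace Phi (- 16)"
proof -
  have norm2: "norm2 = mode_field 0 0 (pi / 2) 0 0 0 1"
    by (simp add: fun_eq_iff mode_field_def frame_section_def phase_def)
  have "jacobi2 Phi (mode_field 0 0 (pi / 2) 0 0 0 1) = mode_field 0 0 (pi / 2) 0 0 0 (- 16)"
    unfolding jacobi2_mode_field by (simp add: jsym_defs lsym_defs)
  also have "\<dots> = (\<lambda>p. - 16 *\<^sub>R norm2 p)"
    by (simp add: fun_eq_iff mode_field_def frame_section_def phase_def)
  finally have "jacobi2 Phi norm2 = (\<lambda>p. - 16 *\<^sub>R norm2 p)"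
    by (subst norm2)
  moreover have "norm2 \<in> sections Phi"
    by (subst norm2) (rule mode_field_in_sections)
  ultimately show ?thesis by (simp add: eigenspace_def)
qed

lemma norm2_nonzero: "norm2 p \<noteq> 0"
  using inner_frame(19)[of p] by auto

lemma index2_Phi: "index2 Phi = 1"
proof -
  have neg: "negative_eigenvalues Phi = {- 16}"
  proof (intro equalityI subsetI)
    fix \<mu> assume "\<mu> \<in> negative_eigenvalues Phi"
    then obtain V p where "\<mu> < 0" "V \<in> eigenspace Phi \<mu>" "V p \<noteq> 0"
      by (auto simp: negative_eigenvalues_def)
    then show "\<mu> \<in> {- 16}" by (metis negative_eigenfield scaleR_zero_left singletonI)
  next
    have "\<exists>V\<in>eigenspace Phi (- 16). \<exists>p. V p \<noteq> 0"
      using norm2_eigenspace norm2_nonzero by blast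
    then show "\<mu> \<in> negative_eigenvalues Phi" if "\<mu> \<in> {- 16}" for \<mu>
      using that by (simp add: negative_eigenvalues_def)
  qed
  have less_1: "{..<1 :: nat} = {0}" by auto
  have "edim (eigenspace Phi (- 16)) = enat 1"
  proof (rule edim_eq_of_basis[where b = "\<lambda>_. norm2"])
    fix V assume "V \<in> eigenspace Phi (- 16)"
    then obtain k where "\<And>p. V p = k *\<^sub>R norm2 p"
      using negative_eigenfield[of V "- 16"] by auto
    then show "\<exists>u. \<forall>p. V p = (\<Sum>i<(1 :: nat). u i *\<^sub>R norm2 p)"
      unfolding less_1 by (intro exI[of _ "\<lambda>_. k"]) simp
  next
    fix u :: "nat \<Rightarrow> real" and i
    assume "\<And>p. (\<Sum>i<(1 :: nat). u i *\<^sub>R norm2 p) = 0" "i < (1 :: nat)"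
    then show "u i = 0"
      unfolding less_1 using norm2_nonzero by simp
  qed (rule norm2_eigenspace)
  then show ?thesis by (simp add: index2_def neg one_enat_def)
qed

section \<open>The kernel of the Jacobi operator\<close>

lemma lessThan_11: "{..<11} = {0, 1, 2, 3, 4, 5, 6, 7, 8, 9, 10 :: nat}"
  by (auto simp: numeral_eq_Suc less_Suc_eq)

text \<open>The first two fields come from rotations of the circle factors. Modes (1, 0) and (0, 1)
  come from rotations mixing one of the two planes with the fifth axis, and modes (1, 1) and (1, -1)
  together from rotations mixing the two planes. Only the third field, the constant multiple of
  \<open>norm1\<close>, is not induced by a Killing field.\<close>

definition kernel_basis :: "nat \<Rightarrow> real \<times> real \<Rightarrow> real^5" where
  "kernel_basis i = [mode_field 0 0 0 1 0 0 0, mode_field 0 0 0 0 1 0 0, mode_field 0 0 (pi / 2) 0 0 1 0,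
     mode_field 1 0 0 2 0 1 (- 2), mode_field 1 0 (pi / 2) 2 0 1 (- 2),
     mode_field 0 1 0 0 2 (- 1) (- 2), mode_field 0 1 (pi / 2) 0 2 (- 1) (- 2),
     mode_field 1 1 0 1 (- 1) 1 0, mode_field 1 1 (pi / 2) 1 (- 1) 1 0,
     mode_field 1 (- 1) 0 1 1 1 0, mode_field 1 (- 1) (pi / 2) 1 1 1 0] ! i"

lemma kernel_basis_in_kernel:
  assumes "i < 11"
  shows "kernel_basis i \<in> kernel Phi"
proof -
  have *: "mode_field m n c x y g h \<in> kernel Phi"
    if "jsym1 (2 * m) (2 * n) x y g h = 0" "jsym2 (2 * m) (2 * n) x y g h = 0"
      "jsym3 (2 * m) (2 * n) x y g h = 0" "jsym4 (2 * m) (2 * n) x y g h = 0" for m n :: int and c x y g h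
    using that mode_field_in_sections[of m n c x y g h]
    by (simp add: kernel_def jacobi2_mode_field) (simp add: mode_field_def frame_section_def)
  have "i \<in> {0, 1, 2, 3, 4, 5, 6, 7, 8, 9, 10}" using assms lessThan_11 by blast
  then show ?thesis
    unfolding kernel_basis_def
    by (elim insertE emptyE; simp only:; simp; intro *) (simp_all add: jsym_defs lsym_defs)
qed

lemma kernel_combination:
  "(\<Sum>i<11. u i *\<^sub>R kernel_basis i p) = frame_section
    (\<lambda>p. u 0 + 2 * u 3 * cos (phase 1 0 0 p) - 2 * u 4 * sin (phase 1 0 0 p)
      + u 7 * cos (phase 1 1 0 p) - u 8 * sin (phase 1 1 0 p)
      + u 9 * cos (phase 1 (- 1) 0 p) - u 10 * sin (phase 1 (- 1) 0 p))
    (\<lambda>p. u 1 + 2 * u 5 * cos (phase 0 1 0 p) - 2 * u 6 * sin (phase 0 1 0 p)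
      - u 7 * cos (phase 1 1 0 p) + u 8 * sin (phase 1 1 0 p)
      + u 9 * cos (phase 1 (- 1) 0 p) - u 10 * sin (phase 1 (- 1) 0 p))
    (\<lambda>p. u 2 + u 3 * sin (phase 1 0 0 p) + u 4 * cos (phase 1 0 0 p)
      - u 5 * sin (phase 0 1 0 p) - u 6 * cos (phase 0 1 0 p)
      + u 7 * sin (phase 1 1 0 p) + u 8 * cos (phase 1 1 0 p)
      + u 9 * sin (phase 1 (- 1) 0 p) + u 10 * cos (phase 1 (- 1) 0 p))
    (\<lambda>p. - 2 * u 3 * sin (phase 1 0 0 p) - 2 * u 4 * cos (phase 1 0 0 p)
      - 2 * u 5 * sin (phase 0 1 0 p) - 2 * u 6 * cos (phase 0 1 0 p)) p"
proof -
  have "phase 0 0 c p = c" for c by (simp add: phase_def)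
  then show ?thesis
    by (simp add: lessThan_11 kernel_basis_def mode_field_def frame_section_algebra frame_section_eq_iff phase_half_pi)
qed

lemma kernel_basis_independent:
  assumes "\<And>p. (\<Sum>i<11. u i *\<^sub>R kernel_basis i p) = 0" "i < 11"
  shows "u i = 0"
proof -
  have eq_0: "frame_section x y g h p = 0 \<longleftrightarrow> x p = 0 \<and> y p = 0 \<and> g p = 0 \<and> h p = 0" for x y g h p
    using frame_section_eq_iff[of x y g h p "\<lambda>_. 0" "\<lambda>_. 0" "\<lambda>_. 0" "\<lambda>_. 0"] by (simp add: frame_section_def)
  note * = assms(1)[unfolded kernel_combination eq_0 phase_def]
  \<comment> \<open>Evaluating the four components at four points gives sixteen linear equations,
    enough to determine the eleven unknowns.\<close>
  have "u 0 = 0 \<and> u 1 = 0 \<and> u 2 = 0 \<and> u 3 = 0 \<and> u 4 = 0 \<and> u 5 = 0 \<and> u 6 = 0 \<and> u 7 = 0 \<and> u 8 = 0 \<and> u 9 = 0 \<and> u 10 = 0"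
    using *[of "(0, 0)"] *[of "(pi, 0)"] *[of "(pi / 2, 0)"] *[of "(0, pi / 2)"]
    by simp
  moreover have "i \<in> {0, 1, 2, 3, 4, 5, 6, 7, 8, 9, 10}" using assms(2) lessThan_11 by blast
  ultimately show ?thesis by auto
qed

text \<open>For \<mu> = 0 every mode form vanishes on the coefficients. High modes are then zero,
  and in each low nonzero mode the three squares express all coefficients through those of one
  tangential component: y for mode (0, 1) and x for the others.\<close>

lemma kernel_expansion:
  assumes "V \<in> kernel Phi"
  shows "\<exists>u. \<forall>p. V p = (\<Sum>i<11. u i *\<^sub>R kernel_basis i p)"
proof -
  obtain x y g h where s: "smooth x" "smooth y" "smooth g" "smooth h"
    and p: "periodic x" "periodic y" "periodic g" "periodic h" and eq: "V = frame_section x y g h"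
    using assms sections_frame_section unfolding kernel_def by blast
  have eigen: "jacobi2 Phi (frame_section x y g h) p = 0 *\<^sub>R frame_section x y g h p" for p
    using assms unfolding eq kernel_def scaleR_zero_left by blast
  have q: "jform (2 * m) (2 * n) (fc x m n c) (fc y m n c) (fs g m n c) (fs h m n c) = 0" for m n :: int and c
    using jform_eigen[OF s p eigen, of m n c] by simp
  have high: "fc x m n c = 0 \<and> fc y m n c = 0 \<and> fs g m n c = 0 \<and> fs h m n c = 0"
    if "1 < \<bar>m\<bar> \<or> 1 < \<bar>n\<bar>" for m n :: int and c
    by (rule jform_high_modes_pos[OF that eq_refl[OF q]])
  have h0: "fc h 0 0 0 = 0"
    using fourier_zero_mode(4)[OF s p eigen, of "pi / 2"] by (simp add: fc_fs_half_pi)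
  have three: "A = 0 \<and> B = 0 \<and> C = 0" if "i * A\<^sup>2 + j * B\<^sup>2 + k * C\<^sup>2 = 0" "0 < i" "0 < j" "0 < k" for i j k A B C :: real
    using sum_of_three_nonpos[OF that(1)[symmetric] order_refl that(2-4)] by simp
  have m10: "fc y 1 0 c = 0" "fs g 1 0 c = fc x 1 0 c / 2" "fs h 1 0 c = - fc x 1 0 c" for c
  proof -
    have "32 * (fc y 1 0 c)\<^sup>2 + 16 * (fs h 1 0 c - 2 * fs g 1 0 c + 2 * fc x 1 0 c)\<^sup>2
        + 16 * (fc x 1 0 c - 2 * fs g 1 0 c)\<^sup>2 = 0"
      using q[of 1 0 c] by (simp add: jform_axis)
    from three[OF this] show "fc y 1 0 c = 0" "fs g 1 0 c = fc x 1 0 c / 2" "fs h 1 0 c = - fc x 1 0 c"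
      by auto
  qed
  have m01: "fc x 0 1 c = 0" "fs g 0 1 c = - fc y 0 1 c / 2" "fs h 0 1 c = - fc y 0 1 c" for c
  proof -
    have "32 * (fc x 0 1 c)\<^sup>2 + 16 * (fs h 0 1 c + 2 * fs g 0 1 c + 2 * fc y 0 1 c)\<^sup>2
        + 16 * (fc y 0 1 c + 2 * fs g 0 1 c)\<^sup>2 = 0"
      using q[of 0 1 c] by (simp add: jform_axis')
    from three[OF this] show "fc x 0 1 c = 0" "fs g 0 1 c = - fc y 0 1 c / 2" "fs h 0 1 c = - fc y 0 1 c"
      by auto
  qed
  have m11: "fc y 1 1 c = - fc x 1 1 c" "fs g 1 1 c = fc x 1 1 c" "fs h 1 1 c = 0" for c
  proof -
    have "80 * (fc x 1 1 c - fc y 1 1 c - 2 * fs g 1 1 c)\<^sup>2 + 64 * (fc x 1 1 c + fc y 1 1 c + fs h 1 1 c)\<^sup>2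
        + 16 * (fs h 1 1 c)\<^sup>2 = 0"
      using q[of 1 1 c] by (simp add: jform_diagonal diff_divide_distrib add_divide_distrib)
    from three[OF this] show "fc y 1 1 c = - fc x 1 1 c" "fs g 1 1 c = fc x 1 1 c" "fs h 1 1 c = 0"
      by auto
  qed
  have m12: "fc y 1 (- 1) c = fc x 1 (- 1) c" "fs g 1 (- 1) c = fc x 1 (- 1) c" "fs h 1 (- 1) c = 0" for c
  proof -
    have "80 * (fc x 1 (- 1) c + fc y 1 (- 1) c - 2 * fs g 1 (- 1) c)\<^sup>2
        + 64 * (fc x 1 (- 1) c - fc y 1 (- 1) c + fs h 1 (- 1) c)\<^sup>2 + 16 * (fs h 1 (- 1) c)\<^sup>2 = 0"
      using q[of 1 "- 1" c] by (simp add: jform_diagonal diff_divide_distrib add_divide_distrib)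
    from three[OF this] show "fc y 1 (- 1) c = fc x 1 (- 1) c" "fs g 1 (- 1) c = fc x 1 (- 1) c" "fs h 1 (- 1) c = 0"
      by auto
  qed
  have hg: "fc g m n c = 0" "fc h m n c = 0" if "1 < \<bar>m\<bar> \<or> 1 < \<bar>n\<bar>" for m n c
    unfolding fc_eq_fs using high[OF that] by simp_all
  note rel = m10[of 0] m01[of 0] m11[of 0] m12[of 0]
  \<comment> \<open>The relations hold at every phase. At pi/2 they link \<open>fs\<close> of the
    tangential components to \<open>fc\<close> of the normal ones, the other half of the real
    coefficients.\<close>
  have rel': "fs y 1 0 0 = 0" "fc g 1 0 0 = - fs x 1 0 0 / 2" "fc h 1 0 0 = fs x 1 0 0"
    "fs x 0 1 0 = 0" "fc g 0 1 0 = fs y 0 1 0 / 2" "fc h 0 1 0 = fs y 0 1 0"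
    "fs y 1 1 0 = - fs x 1 1 0" "fc g 1 1 0 = - fs x 1 1 0" "fc h 1 1 0 = 0"
    "fs y 1 (- 1) 0 = fs x 1 (- 1) 0" "fc g 1 (- 1) 0 = - fs x 1 (- 1) 0" "fc h 1 (- 1) 0 = 0"
    using m10[of "pi / 2"] m01[of "pi / 2"] m11[of "pi / 2"] m12[of "pi / 2"]
    unfolding fc_fs_half_pi by linarith+
  define w where "w = 1 / pi\<^sup>2"
  have expansion: "f p = w * fc f 0 0 0 + 2 * w * (fc f 1 0 0 * cos (phase 1 0 0 p) + fs f 1 0 0 * sin (phase 1 0 0 p)
      + (fc f 0 1 0 * cos (phase 0 1 0 p) + fs f 0 1 0 * sin (phase 0 1 0 p))
      + (fc f 1 1 0 * cos (phase 1 1 0 p) + fs f 1 1 0 * sin (phase 1 1 0 p))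
      + (fc f 1 (- 1) 0 * cos (phase 1 (- 1) 0 p) + fs f 1 (- 1) 0 * sin (phase 1 (- 1) 0 p)))"
    if "smooth f" "periodic f" "\<forall>m n c. 1 < \<bar>m\<bar> \<or> 1 < \<bar>n\<bar> \<longrightarrow> fc f m n c = 0" for f p
    using fourier_expansion_low_modes[OF that(1,2), of p] that(3) by (simp add: w_def add.assoc)
  have vanish: "\<forall>m n c. 1 < \<bar>m\<bar> \<or> 1 < \<bar>n\<bar> \<longrightarrow> fc f m n c = 0" if "f \<in> {x, y, g, h}" for f
    using that high hg by (elim insertE emptyE) (simp_all only:, blast+)
  \<comment> \<open>The expansion weights nonzero modes by 2w. The basis fields of modes (1, 0) and
    (0, 1) have leading coefficient 2, which absorbs that factor; those of the diagonal modes have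
    1. The minus signs occur because a cosine of phase pi/2 is minus the sine.\<close>
  define u where "u i = w * [fc x 0 0 0, fc y 0 0 0, fc g 0 0 0, fc x 1 0 0, - fs x 1 0 0, fc y 0 1 0, - fs y 0 1 0,
      2 * fc x 1 1 0, - (2 * fs x 1 1 0), 2 * fc x 1 (- 1) 0, - (2 * fs x 1 (- 1) 0)] ! i" for i
  have u: "u 0 = w * fc x 0 0 0" "u 1 = w * fc y 0 0 0" "u 2 = w * fc g 0 0 0"
    "u 3 = w * fc x 1 0 0" "u 4 = - (w * fs x 1 0 0)" "u 5 = w * fc y 0 1 0" "u 6 = - (w * fs y 0 1 0)"
    "u 7 = 2 * w * fc x 1 1 0" "u 8 = - (2 * w * fs x 1 1 0)"
    "u 9 = 2 * w * fc x 1 (- 1) 0" "u 10 = - (2 * w * fs x 1 (- 1) 0)"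
    by (simp_all add: u_def)
  have "V p = (\<Sum>i<11. u i *\<^sub>R kernel_basis i p)" for p
    unfolding eq kernel_combination frame_section_eq_iff
    unfolding u expansion[OF s(1) p(1) vanish[OF insertI1], of p] expansion[OF s(2) p(2) vanish[OF insertI2[OF insertI1]], of p]
      expansion[OF s(3) p(3) vanish[OF insertI2[OF insertI2[OF insertI1]]], of p] expansion[OF s(4) p(4) vanish[OF insertI2[OF insertI2[OF insertI2[OF insertI1]]]], of p] rel rel' h0
    by (simp add: algebra_simps)
  then show ?thesis by blast
qed

lemma null2_Phi: "null2 Phi = 11"
proof -
  have "edim (kernel Phi) = enat 11"
    by (rule edim_eq_of_basis) (fact kernel_basis_in_kernel kernel_expansion kernel_basis_independent)+
  then show ?thesis by (simp add: null2_def numeral_eq_enat)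
qed

theorem theorem1p2:
  shows "isometric_immersion Phi \<and> proper_biharmonic Phi \<and> index2 Phi = 1 \<and> null2 Phi = 11"
  using isometric_immersion_Phi proper_biharmonic_Phi index2_Phi null2_Phi by blast

end
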